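(* (Model A) Suppose that either $d\in\{1,2\}$, or $d\ge3$ and $\mathbb{E}(\xi(0))\neq0$. Then the infinite-volume surface tension does not exist: for every $u\in\mathbb{R}^d$ and $\mathbb P$-almost every $\xi$, the limit $\lim_{N\to\infty}\sigma_{\Lambda_N}[\xi](u)$ does not exist as a real number.
   Context: Model A: $V\in C^2(\mathbb{R})$ is even, with $V(s)\ge As^2-B$ for all $s$ (some $A>0$, $B\in\mathbb{R}$) and $V''(s)\le C_2$ (some $C_2>0$). The disorder $(\xi(x))_{x\in\mathbb{Z}^d}$ is an i.i.d. family of real random variables with finite nonzero second moment, with law $\mathbb P$ and expectation $\mathbb E$. For finite $\Lambda\subset\mathbb{Z}^d$, $\partial\Lambda=\{x\notin\Lambda:\|x-y\|_1=1\text{ for some }y\in\Lambda\}$; for $\psi\in\mathbb{R}^{\mathbb{Z}^d}$, $$H^\psi_\Lambda[\xi](\phi)=\tfrac12\sum_{x,y\in\Lambda,|x-y|=1}V(\phi(x)-\phi(y))+\sum_{x\in\Lambda,y\in\partial\Lambda,|x-y|=1}V(\phi(x)-\psi(y))+\tfrac12\sum_{x\in\Lambda}\xi(x)\phi(x),$$ sums over ordered nearest-neighbour pairs, with $\phi=\psi$ off $\Lambda$. Let $\Lambda_N=[-N,N]^d\cap\mathbb{Z}^d$, $\psi_u(x)=x\cdot u$, $Z^{\psi_u}_{\Lambda_N}[\xi]=\int_{\mathbb{R}^{\Lambda_N}}\exp(-H^{\psi_u}_{\Lambda_N}[\xi](\phi))\prod_{x\in\Lambda_N}\mathrm{d}\phi(x)$,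 and the finite-volume surface tension $\sigma_{\Lambda_N}[\xi](u)=-\frac{1}{|\Lambda_N|}\log Z^{\psi_u}_{\Lambda_N}[\xi]$. *)

theory Defs
  imports "HOL-Probability.Probability"
begin

definition lat_adj :: "int^'d \<Rightarrow> int^'d \<Rightarrow> bool" where
  "lat_adj x y \<longleftrightarrow> (\<Sum>i\<in>UNIV. \<bar>x$i - y$i\<bar>) = 1"

definition lat_boundary :: "(int^'d) set \<Rightarrow> (int^'d) set" where
  "lat_boundary \<Lambda> = {x. x \<notin> \<Lambda> \<and> (\<exists>y\<in>\<Lambda>. lat_adj x y)}"

definition box :: "nat \<Rightarrow> (int^'d) set" where
  "box N = {x. \<forall>i. - int N \<le> x$i \<and> x$i \<le> int N}"

definition tilt :: "real^'d \<Rightarrow> int^'d \<Rightarrow> real" where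
  "tilt u x = (\<Sum>i\<in>UNIV. real_of_int (x$i) * u$i)"

definition hamiltonian ::
  "(real \<Rightarrow> real) \<Rightarrow> (int^'d) set \<Rightarrow> (int^'d \<Rightarrow> real) \<Rightarrow> (int^'d \<Rightarrow> real)
     \<Rightarrow> (int^'d \<Rightarrow> real) \<Rightarrow> real" where
  "hamiltonian V \<Lambda> psi xi phi =
     (let f = (\<lambda>x. if x \<in> \<Lambda> then phi x else psi x) in
       (1/2) * (\<Sum>p\<in>{(x,y). x \<in> \<Lambda> \<and> y \<in> \<Lambda> \<and> lat_adj x y}. V (f (fst p) - f (snd p)))
     + (\<Sum>p\<in>{(x,y). x \<in> \<Lambda> \<and> y \<in> lat_boundary \<Lambda> \<and> lat_adj x y}. V (f (fst p) - psi (snd p)))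
     + (1/2) * (\<Sum>x\<in>\<Lambda>. xi x * f x))"

definition partition_fn ::
  "(real \<Rightarrow> real) \<Rightarrow> (int^'d) set \<Rightarrow> (int^'d \<Rightarrow> real) \<Rightarrow> (int^'d \<Rightarrow> real) \<Rightarrow> real" where
  "partition_fn V \<Lambda> psi xi =
     (\<integral>phi. exp (- hamiltonian V \<Lambda> psi xi phi) \<partial>(PiM \<Lambda> (\<lambda>_. lborel)))"

definition surface_tension ::
  "(real \<Rightarrow> real) \<Rightarrow> nat \<Rightarrow> (int^'d \<Rightarrow> real) \<Rightarrow> real^'d \<Rightarrow> real" where
  "surface_tension V N xi u =
     - (1 / real (card (box N :: (int^'d) set))) * ln (partition_fn V (box N) (tilt u) xi)"

end

theory Submission
  imports Defs "HOL-Real_Asymp.Real_Asymp"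
begin

text \<open>
  Restricting the partition function to the unit cube around \<open>tilt u + h\<close>, where \<open>h\<close> vanishes off the box \<open>\<Lambda>\<close> and
  may depend on \<open>\<xi>\<close>, and bounding \<open>V\<close> from above by a parabola gives
  \<open>log Z \<ge> - c \<bar>\<Lambda>\<bar> - 3 C E(h) - <\<xi>, tilt u> / 2 - <\<xi>, h> / 2 - \<Sum> \<bar>\<xi>\<bar> / 4\<close> with \<open>E\<close> the Dirichlet energy.
  It therefore suffices to find \<open>h\<close> whose gain \<open>- <\<xi>, h>\<close> beats its energy by more than a constant times \<open>\<bar>\<Lambda>\<bar>\<close>
  with probability close to one: then almost surely the surface tensions are unbounded below.

  If \<open>\<xi>\<close> has mean \<open>\<mu> \<noteq> 0\<close>, take \<open>h = - sgn \<mu> * dist(\<cdot>, \<partial>\<Lambda>)\<close>, with gain of order \<open>N \<bar>\<Lambda>\<bar>\<close> and energy of order \<open>\<bar>\<Lambda>\<bar>\<close>.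
  If the mean vanishes and \<open>d \<le> 2\<close>, take \<open>h = - \<lambda> G \<eta>\<close> with \<open>\<eta>\<close> the centred truncation of \<open>\<xi>\<close> and \<open>G\<close> an explicit
  substitute for the Green function at scale \<open>R\<close>. Gain and energy per site are both of order
  \<open>G(0)\<close>, which is \<open>R\<close> in dimension one and \<open>log R\<close> in dimension two, so a small \<open>\<lambda>\<close> wins. Truncating one of the two factors makes
  second moments of \<open>\<xi>\<close> sufficient for Chebyshev's inequality.
\<close>

section \<open>Lattice boxes and edge sums\<close>

text \<open>The max norm with values in \<open>nat\<close>: boxes become its balls, and radial sums
  and boundary distances can be written in natural-number arithmetic.\<close>

definition sup_norm :: "int^'d \<Rightarrow> nat" where
  "sup_norm x = Max (range (\<lambda>i. nat \<bar>x$i\<bar>))"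

definition unit_steps :: "(int^'d) set" where
  "unit_steps = {z. (\<Sum>i\<in>UNIV. \<bar>z$i\<bar>) = 1}"

lemma sup_norm_le_iff: "sup_norm x \<le> n \<longleftrightarrow> x \<in> box n"
proof -
  have "sup_norm x \<le> n \<longleftrightarrow> (\<forall>i. nat \<bar>x$i\<bar> \<le> n)"
    unfolding sup_norm_def by (subst Max_le_iff) auto
  also have "\<dots> \<longleftrightarrow> x \<in> box n"
    unfolding box_def mem_Collect_eq
  proof (intro iff_allI)
    fix i show "(nat \<bar>x$i\<bar> \<le> n) = (- int n \<le> x$i \<and> x$i \<le> int n)" by linarith
  qed
  finally show ?thesis .
qed

lemma box_iff: "x \<in> box n \<longleftrightarrow> (\<forall>i. \<bar>x$i\<bar> \<le> int n)"
  unfolding box_def by (auto simp: abs_le_iff) (smt (verit) )+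

lemma in_box_sup_norm: "x \<in> box (sup_norm x)"
  using sup_norm_le_iff by blast

lemma box_add: "x \<in> box m \<Longrightarrow> y \<in> box n \<Longrightarrow> x + y \<in> box (m + n)"
  unfolding box_iff using abs_triangle_ineq order_trans add_mono
  by (metis (no_types, opaque_lifting) of_nat_add vector_add_component)

lemma box_uminus: "- x \<in> box n \<longleftrightarrow> x \<in> box n"
  unfolding box_iff by simp

lemma box_mono: "m \<le> n \<Longrightarrow> box m \<subseteq> box n"
  by (meson order_trans subsetI sup_norm_le_iff)

lemma sup_norm_triangle: "sup_norm (x + y) \<le> sup_norm x + sup_norm y"
  using box_add in_box_sup_norm sup_norm_le_iff by blast

lemma sup_norm_uminus: "sup_norm (- x) = sup_norm x"
  by (metis box_uminus sup_norm_le_iff le_antisym order_refl)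

lemma sup_norm_0 [simp]: "sup_norm 0 = 0"
  using sup_norm_le_iff[of 0 0] by (simp add: box_iff)

lemma unit_steps_sup_norm: "z \<in> unit_steps \<Longrightarrow> sup_norm z \<le> 1"
proof -
  assume z: "z \<in> unit_steps"
  have "\<bar>z$i\<bar> \<le> 1" for i
    using member_le_sum[of i UNIV "\<lambda>i. \<bar>z$i\<bar>"] z by (simp add: unit_steps_def)
  then show ?thesis by (simp add: sup_norm_le_iff box_iff)
qed

lemma unit_steps_uminus: "z \<in> unit_steps \<Longrightarrow> - z \<in> unit_steps"
  by (simp add: unit_steps_def)

lemma sup_norm_step_le:
  assumes "z \<in> unit_steps"
  shows "sup_norm (x + z) \<le> Suc (sup_norm x)"
  using sup_norm_triangle[of x z] unit_steps_sup_norm[OF assms] by linarith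

lemma sup_norm_step_ge:
  assumes "z \<in> unit_steps"
  shows "sup_norm x \<le> Suc (sup_norm (x + z))"
  using sup_norm_step_le[OF unit_steps_uminus[OF assms], of "x + z"] by simp

lemma lat_adj_iff: "lat_adj x y \<longleftrightarrow> y - x \<in> unit_steps"
  unfolding lat_adj_def unit_steps_def by (simp add: abs_minus_commute)

text \<open>Transfers the box to a finite product of integer intervals, where
  \<open>card_PiE\<close> counts it.\<close>

lemma bij_betw_box: "bij_betw vec_lambda (UNIV \<rightarrow>\<^sub>E {- int n..int n}) (box n :: (int^'d) set)"
proof (rule bij_betw_byWitness[where f' = vec_nth])
  show "vec_nth ` (box n :: (int^'d) set) \<subseteq> UNIV \<rightarrow>\<^sub>E {- int n..int n}"
    by (auto simp: box_def)
  show "vec_lambda ` (UNIV \<rightarrow>\<^sub>E {- int n..int n}) \<subseteq> (box n :: (int^'d) set)"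
    by (auto simp: box_def PiE_def Pi_def)
qed (auto simp: vec_lambda_inverse)

lemma finite_box [simp]: "finite (box n :: (int^'d) set)"
  using bij_betw_finite[OF bij_betw_box] by (metis finite_PiE finite_atLeastAtMost_int finite)

lemma card_box: "card (box n :: (int^'d) set) = (2 * n + 1) ^ CARD('d)"
proof -
  have "bij_betw vec_lambda (UNIV \<rightarrow>\<^sub>E {- int n..int n}) (box n :: (int^'d) set)"
    by (rule bij_betw_box)
  from bij_betw_same_card[OF this] show ?thesis
    by (simp add: card_PiE nat_add_distrib nat_mult_distrib)
qed

lemma card_box_pos: "card (box n :: (int^'d) set) > 0"
  by (simp add: card_box)

lemma finite_unit_steps [simp]: "finite (unit_steps :: (int^'d) set)"
proof (rule finite_subset)
  show "(unit_steps :: (int^'d) set) \<subseteq> box 1"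
    using unit_steps_sup_norm sup_norm_le_iff by blast
qed simp

lemma axis_in_unit_steps: "axis i 1 \<in> (unit_steps :: (int^'d) set)"
  by (simp add: unit_steps_def axis_def if_distrib cong: if_cong)

section \<open>The linear boundary condition\<close>

lemma tilt_add: "tilt u (x + y) = tilt u x + tilt u y"
  by (simp add: tilt_def algebra_simps sum.distrib)

lemma tilt_uminus: "tilt u (- x) = - tilt u x"
  by (simp add: tilt_def sum_negf)

lemma abs_tilt_le: "x \<in> box n \<Longrightarrow> \<bar>tilt u x\<bar> \<le> real n * (\<Sum>i\<in>UNIV. \<bar>u$i\<bar>)"
proof -
  assume x: "x \<in> box n"
  have "\<bar>tilt u x\<bar> \<le> (\<Sum>i\<in>UNIV. \<bar>real_of_int (x$i) * u$i\<bar>)"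
    unfolding tilt_def by (rule sum_abs)
  also have "\<dots> \<le> (\<Sum>i\<in>UNIV. real n * \<bar>u$i\<bar>)"
  proof (rule sum_mono)
    fix i :: 'a
    have "\<bar>x$i\<bar> \<le> int n" using x by (simp add: box_iff)
    then have "\<bar>real_of_int (x$i)\<bar> \<le> real n" by linarith
    then show "\<bar>real_of_int (x$i) * u$i\<bar> \<le> real n * \<bar>u$i\<bar>"
      by (simp add: abs_mult mult_right_mono)
  qed
  finally show ?thesis by (simp add: sum_distrib_left)
qed

text \<open>The box is invariant under reflection in the origin and the tilt is odd. This removes
  the mean of the disorder from the tilt term.\<close>

lemma sum_tilt_box: "(\<Sum>x\<in>box n. tilt u x) = 0"
proof -
  have "(\<Sum>x\<in>box n. tilt u x) = (\<Sum>x\<in>box n. tilt u (- x))"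
    by (rule sum.reindex_bij_witness[of _ uminus uminus]) (auto simp: box_uminus)
  then show ?thesis by (simp add: tilt_uminus sum_negf)
qed

text \<open>Oriented edges starting in \<open>\<Lambda>\<close>: an inner edge occurs in both
  orientations, a boundary edge once, pointing outwards.\<close>

definition edges :: "(int^'d) set \<Rightarrow> ((int^'d) \<times> (int^'d)) set" where
  "edges \<Lambda> = {(x, y). x \<in> \<Lambda> \<and> lat_adj x y}"

lemma sum_edges:
  fixes F :: "(int^'d) \<times> (int^'d) \<Rightarrow> real"
  assumes "finite \<Lambda>"
  shows "(\<Sum>p\<in>edges \<Lambda>. F p) = (\<Sum>x\<in>\<Lambda>. \<Sum>z\<in>unit_steps. F (x, x + z))"
proof -
  have "(\<Sum>p\<in>edges \<Lambda>. F p) = (\<Sum>(x,z)\<in>\<Lambda> \<times> unit_steps. F (x, x + z))"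
    by (rule sum.reindex_bij_witness[of _ "\<lambda>(x,z). (x, x + z)" "\<lambda>(x,y). (x, y - x)"])
       (auto simp: edges_def lat_adj_iff)
  then show ?thesis by (simp add: sum.cartesian_product)
qed

lemma finite_edges:
  assumes "finite (\<Lambda> :: (int^'d) set)"
  shows "finite (edges \<Lambda>)"
proof (rule finite_subset)
  show "edges \<Lambda> \<subseteq> (\<lambda>(x,z). (x, x + z)) ` (\<Lambda> \<times> unit_steps)"
    by (force simp: edges_def lat_adj_iff image_iff)
qed (use assms in simp)

text \<open>A neighbour of a point of \<open>\<Lambda>\<close> lies in \<open>\<Lambda>\<close> or
  in its outer boundary; these are the two index sets of the Hamiltonian.\<close>

lemma edges_split:
  "edges \<Lambda> = {(x,y). x \<in> \<Lambda> \<and> y \<in> \<Lambda> \<and> lat_adj x y} \<union> {(x,y). x \<in> \<Lambda> \<and> y \<in> lat_boundary \<Lambda> \<and> lat_adj x y}"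
  "{(x,y). x \<in> \<Lambda> \<and> y \<in> \<Lambda> \<and> lat_adj x y} \<inter> {(x,y). x \<in> \<Lambda> \<and> y \<in> lat_boundary \<Lambda> \<and> lat_adj x y} = {}"
proof -
  have sym: "lat_adj x y \<longleftrightarrow> lat_adj y x" for x y :: "int^'a"
    by (simp add: lat_adj_def abs_minus_commute)
  show "edges \<Lambda> = {(x,y). x \<in> \<Lambda> \<and> y \<in> \<Lambda> \<and> lat_adj x y} \<union> {(x,y). x \<in> \<Lambda> \<and> y \<in> lat_boundary \<Lambda> \<and> lat_adj x y}"
    unfolding edges_def lat_boundary_def using sym by auto
qed (auto simp: lat_boundary_def)

text \<open>Names the local function \<open>f\<close> of \<open>hamiltonian\<close>, so that its
  gradients can be manipulated.\<close>

definition extend :: "(int^'d) set \<Rightarrow> (int^'d \<Rightarrow> real) \<Rightarrow> (int^'d \<Rightarrow> real) \<Rightarrow> int^'d \<Rightarrow> real" where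
  "extend \<Lambda> psi phi x = (if x \<in> \<Lambda> then phi x else psi x)"

text \<open>Boundary points lie off \<open>\<Lambda>\<close>, so \<open>psi\<close> there is the
  extended field: every interaction becomes a gradient of one global function.\<close>

lemma hamiltonian_eq:
  "hamiltonian V \<Lambda> psi xi phi =
     (1/2) * (\<Sum>p\<in>{(x,y). x \<in> \<Lambda> \<and> y \<in> \<Lambda> \<and> lat_adj x y}.
        V (extend \<Lambda> psi phi (fst p) - extend \<Lambda> psi phi (snd p)))
     + (\<Sum>p\<in>{(x,y). x \<in> \<Lambda> \<and> y \<in> lat_boundary \<Lambda> \<and> lat_adj x y}.
        V (extend \<Lambda> psi phi (fst p) - extend \<Lambda> psi phi (snd p)))
     + (1/2) * (\<Sum>x\<in>\<Lambda>. xi x * phi x)"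
  unfolding hamiltonian_def Let_def extend_def
  by (intro arg_cong2[where f = "(+)"] arg_cong2[where f = "(*)"] sum.cong refl)
     (auto simp: lat_boundary_def)

text \<open>Inner edges carry weight 1/2 in the Hamiltonian and weight 1 on the right; as
  \<open>v\<close> is nonnegative, raising the weight only increases the sum.\<close>

lemma hamiltonian_upper:
  assumes fin: "finite \<Lambda>" and V: "\<And>s. V s \<le> v s" and v: "\<And>s. v s \<ge> 0"
  shows "hamiltonian V \<Lambda> psi xi phi \<le>
     (\<Sum>x\<in>\<Lambda>. \<Sum>z\<in>unit_steps. v (extend \<Lambda> psi phi x - extend \<Lambda> psi phi (x + z)))
     + (1/2) * (\<Sum>x\<in>\<Lambda>. xi x * phi x)"
proof -
  let ?f = "extend \<Lambda> psi phi"
  let ?P = "{(x,y). x \<in> \<Lambda> \<and> y \<in> \<Lambda> \<and> lat_adj x y}"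
  let ?Q = "{(x,y). x \<in> \<Lambda> \<and> y \<in> lat_boundary \<Lambda> \<and> lat_adj x y}"
  let ?F = "\<lambda>p. ?f (fst p) - ?f (snd p)"
  have fPQ: "finite ?P" "finite ?Q"
    using finite_edges[OF fin] unfolding edges_split(1) by auto
  have *: "(\<Sum>p\<in>?P. v (?F p)) + (\<Sum>p\<in>?Q. v (?F p)) = (\<Sum>p\<in>edges \<Lambda>. v (?F p))"
    unfolding edges_split(1) by (rule sum.union_disjoint[symmetric]) (use fPQ edges_split(2) in auto)
  have "(\<Sum>p\<in>?P. V (?F p)) \<le> (\<Sum>p\<in>?P. v (?F p))" "(\<Sum>p\<in>?Q. V (?F p)) \<le> (\<Sum>p\<in>?Q. v (?F p))"
    by (intro sum_mono V)+
  moreover have "(\<Sum>p\<in>?P. v (?F p)) \<ge> 0" by (intro sum_nonneg v)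
  ultimately show ?thesis
    unfolding hamiltonian_eq using * sum_edges[OF fin, of "\<lambda>p. v (?F p)"] by simp
qed

text \<open>Boundary edges are lowered from weight 1 to 1/2, using that \<open>v\<close> is
  nonnegative, and every oriented edge is charged the full constant \<open>b\<close>.\<close>

lemma hamiltonian_lower:
  assumes fin: "finite \<Lambda>" and V: "\<And>s. V s \<ge> v s - b" and v: "\<And>s. v s \<ge> 0" and b: "b \<ge> 0"
  shows "hamiltonian V \<Lambda> psi xi phi \<ge>
     (1/2) * (\<Sum>p\<in>edges \<Lambda>. v (extend \<Lambda> psi phi (fst p) - extend \<Lambda> psi phi (snd p)))
     - b * real (card (edges \<Lambda>)) + (1/2) * (\<Sum>x\<in>\<Lambda>. xi x * phi x)"
proof -
  let ?f = "extend \<Lambda> psi phi"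
  let ?P = "{(x,y). x \<in> \<Lambda> \<and> y \<in> \<Lambda> \<and> lat_adj x y}"
  let ?Q = "{(x,y). x \<in> \<Lambda> \<and> y \<in> lat_boundary \<Lambda> \<and> lat_adj x y}"
  let ?F = "\<lambda>p. ?f (fst p) - ?f (snd p)"
  have fPQ: "finite ?P" "finite ?Q"
    using finite_edges[OF fin] unfolding edges_split(1) by auto
  have *: "(\<Sum>p\<in>?P. v (?F p)) + (\<Sum>p\<in>?Q. v (?F p)) = (\<Sum>p\<in>edges \<Lambda>. v (?F p))"
    unfolding edges_split(1) by (rule sum.union_disjoint[symmetric]) (use fPQ edges_split(2) in auto)
  have c: "card ?P + card ?Q = card (edges \<Lambda>)"
    unfolding edges_split(1) by (rule card_Un_disjoint[symmetric]) (use fPQ edges_split(2) in auto)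
  have "(\<Sum>p\<in>?P. V (?F p)) \<ge> (\<Sum>p\<in>?P. v (?F p) - b)" "(\<Sum>p\<in>?Q. V (?F p)) \<ge> (\<Sum>p\<in>?Q. v (?F p) - b)"
    by (intro sum_mono V)+
  then have s: "(\<Sum>p\<in>?P. V (?F p)) \<ge> (\<Sum>p\<in>?P. v (?F p)) - b * card ?P"
    "(\<Sum>p\<in>?Q. V (?F p)) \<ge> (\<Sum>p\<in>?Q. v (?F p)) - b * card ?Q"
    by (simp_all add: sum_subtractf mult.commute)
  have "(\<Sum>p\<in>?Q. v (?F p)) \<ge> 0" by (intro sum_nonneg v)
  moreover have "b * card (edges \<Lambda>) = b * card ?P + b * card ?Q"
    by (simp add: c[symmetric] algebra_simps)
  moreover have "b * card ?P \<ge> 0" using b by simp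
  ultimately show ?thesis
    unfolding hamiltonian_eq using * s by linarith
qed

section \<open>Bounds on the partition function\<close>

lemma sq_add_le: "(a + b :: real)^2 \<le> 2 * a^2 + 2 * b^2"
  using zero_le_power2[of "a - b"] by (simp add: power2_eq_square algebra_simps)

lemma sq_add3_le: "(a + b + c :: real)^2 \<le> 3 * (a^2 + b^2 + c^2)"
  using zero_le_power2[of "a - b"] zero_le_power2[of "a - c"] zero_le_power2[of "b - c"]
  by (simp add: power2_eq_square algebra_simps)

text \<open>Evenness forces \<open>V' 0 = 0\<close>, so two applications of the mean value theorem
  bound \<open>V s - V 0\<close> by \<open>s * (C * s)\<close> for positive \<open>s\<close>;
  symmetry covers negative \<open>s\<close>.\<close>

lemma even_potential_upper:
  fixes V V' V'' :: "real \<Rightarrow> real"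
  assumes V_deriv: "\<And>s. (V has_real_derivative V' s) (at s)"
    and V'_deriv: "\<And>s. (V' has_real_derivative V'' s) (at s)"
    and V_even: "\<And>s. V (- s) = V s"
    and V''_upper: "\<And>s. V'' s \<le> C" and "C \<ge> 0"
  shows "V s \<le> V 0 + C * s^2"
proof -
  have "((\<lambda>s. V (- s)) has_real_derivative - V' 0) (at 0)"
    using DERIV_mirror[of V "V' 0" 0] V_deriv[of 0] by simp
  then have "(V has_real_derivative - V' 0) (at 0)" by (simp add: V_even)
  from DERIV_unique[OF this V_deriv[of 0]] have V'0: "V' 0 = 0" by simp
  have pos: "V s \<le> V 0 + C * s^2" if "s > 0" for s
  proof -
    obtain t where t: "0 < t" "t < s" "V s - V 0 = (s - 0) * V' t"
      using MVT2[OF \<open>s > 0\<close>, of V V'] V_deriv by blast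
    obtain r where r: "V' t - V' 0 = (t - 0) * V'' r"
      using MVT2[OF \<open>t > 0\<close>, of V' V''] V'_deriv by blast
    have "V' t \<le> C * s"
    proof -
      have "V' t = t * V'' r" using r V'0 by simp
      also have "\<dots> \<le> t * C" using t V''_upper by (intro mult_left_mono) auto
      also have "\<dots> \<le> s * C" using t \<open>C \<ge> 0\<close> by (intro mult_right_mono) auto
      finally show ?thesis by (simp add: mult.commute)
    qed
    then have "s * V' t \<le> s * (C * s)" using that by (intro mult_left_mono) auto
    then show ?thesis using t by (simp add: power2_eq_square algebra_simps)
  qed
  show ?thesis
    using pos[of s] pos[of "- s"] V_even[of s] by (cases s "0 :: real" rule: linorder_cases) auto
qed

text \<open>Walk from \<open>x\<close> in direction \<open>e\<close> until \<open>\<Lambda>\<close>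
  is left. The value at the exit is boundary data, and each step back adds one edge increment
  through \<open>sq_add_le\<close>, at the price of a factor \<open>4\<close>.\<close>

lemma extend_sq_le:
  fixes \<Lambda> :: "(int^'d) set" and psi phi :: "int^'d \<Rightarrow> real"
  defines "f \<equiv> extend \<Lambda> psi phi"
  defines "E \<equiv> (\<Sum>p\<in>edges \<Lambda>. (f (fst p) - f (snd p))^2)"
  assumes fin: "finite \<Lambda>" "finite (lat_boundary \<Lambda>)"
    and e: "e \<in> unit_steps"
    and "x \<in> \<Lambda>" "((\<lambda>y. y + e) ^^ n) x \<notin> \<Lambda>"
  shows "(f x)^2 \<le> 4^n * (E + (\<Sum>y\<in>lat_boundary \<Lambda>. (psi y)^2))"
  using \<open>x \<in> \<Lambda>\<close> \<open>((\<lambda>y. y + e) ^^ n) x \<notin> \<Lambda>\<close>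
proof (induction n arbitrary: x)
  case (Suc n)
  define S where "S = (\<Sum>y\<in>lat_boundary \<Lambda>. (psi y)^2)"
  have E0: "E \<ge> 0" and S0: "S \<ge> 0" by (auto simp: E_def S_def intro: sum_nonneg)
  have adj: "lat_adj x (x + e)" using e by (simp add: lat_adj_iff)
  have "(f (fst (x, x+e)) - f (snd (x, x+e)))^2 \<le> E"
    unfolding E_def using adj Suc.prems(1) finite_edges[OF fin(1)]
    by (intro member_le_sum) (auto simp: edges_def)
  then have 1: "(f x - f (x + e))^2 \<le> E" by simp
  have "(f (x + e))^2 \<le> 4^n * (E + S)"
  \<comment> \<open>The walk may leave \<open>\<Lambda>\<close> before its last step. It then stops
    at the first exit, which is a boundary point, and \<open>4^n \<ge> 1\<close> covers the
    remaining steps.\<close>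
  proof (cases "x + e \<in> \<Lambda>")
    case True
    then show ?thesis using Suc.IH[of "x + e"] Suc.prems(2) unfolding S_def
      by (simp add: funpow_Suc_right del: funpow.simps)
  next
    case False
    have "lat_adj (x + e) x" using adj by (simp add: lat_adj_def abs_minus_commute)
    then have "x + e \<in> lat_boundary \<Lambda>"
      using False Suc.prems(1) by (auto simp: lat_boundary_def)
    then have "(psi (x + e))^2 \<le> S" unfolding S_def by (intro member_le_sum fin) auto
    moreover have "f (x + e) = psi (x + e)" using False by (simp add: f_def extend_def)
    moreover have "1 * (E + S) \<le> 4^n * (E + S)" using E0 S0 by (intro mult_right_mono) auto
    ultimately show ?thesis using E0 by simp
  qed
  moreover have "(f x)^2 \<le> 2 * (f x - f (x+e))^2 + 2 * (f (x+e))^2"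
    using sq_add_le[of "f x - f (x+e)" "f (x+e)"] by simp
  \<comment> \<open>Closes the recursion:
    \<open>2 * E + 2 * 4^n * (E + S) \<le> 4^(Suc n) * (E + S)\<close>.\<close>
  moreover have "1 * E \<le> 4^n * (E + S)" using E0 S0 by (intro mult_mono) auto
  ultimately show ?case using 1 unfolding S_def by simp
qed simp

lemma finite_lat_boundary:
  assumes "finite (\<Lambda> :: (int^'d) set)"
  shows "finite (lat_boundary \<Lambda>)"
proof (rule finite_subset)
  show "lat_boundary \<Lambda> \<subseteq> (\<lambda>(y,z). y - z) ` (\<Lambda> \<times> unit_steps)"
  proof
    fix x assume "x \<in> lat_boundary \<Lambda>"
    then obtain y where "y \<in> \<Lambda>" "y - x \<in> unit_steps"
      by (auto simp: lat_boundary_def lat_adj_iff)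
    then show "x \<in> (\<lambda>(y,z). y - z) ` (\<Lambda> \<times> unit_steps)"
      by (intro image_eqI[where x = "(y, y - x)"]) auto
  qed
qed (use assms in simp)

lemma funpow_add_axis: "((\<lambda>y. y + axis i 1) ^^ n) x $ i = x $ i + int n"
  for x :: "int^'d"
  by (induction n) auto

text \<open>A discrete Poincare inequality with boundary data: \<open>2 * N + 1\<close> steps along
  an axis leave the box from any of its points. The constants deteriorate with \<open>N\<close>,
  which is harmless because they only serve integrability.\<close>

lemma dirichlet_coercive_box:
  fixes psi :: "int^'d \<Rightarrow> real"
  shows "\<exists>\<kappa> S. \<kappa> > 0 \<and> (\<forall>phi. (\<Sum>p\<in>edges (box N). (extend (box N) psi phi (fst p) - extend (box N) psi phi (snd p))^2)
       \<ge> \<kappa> * (\<Sum>x\<in>box N. (phi x)^2) - S)"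
proof -
  let ?\<Lambda> = "box N :: (int^'d) set"
  define S where "S = (\<Sum>y\<in>lat_boundary ?\<Lambda>. (psi y)^2)"
  define c :: real where "c = card ?\<Lambda> * 4^(2*N+1)"
  have c: "c > 0" using card_box_pos[of N, where 'd='d] by (simp add: c_def)
  have "(\<Sum>p\<in>edges ?\<Lambda>. (extend ?\<Lambda> psi phi (fst p) - extend ?\<Lambda> psi phi (snd p))^2)
       \<ge> (1/c) * (\<Sum>x\<in>?\<Lambda>. (phi x)^2) - S" (is "?E \<ge> _") for phi
  proof -
    have "(\<Sum>x\<in>?\<Lambda>. (phi x)^2) \<le> (\<Sum>x\<in>?\<Lambda>. 4^(2*N+1) * (?E + S))"
    proof (rule sum_mono)
      fix x assume x: "x \<in> ?\<Lambda>"
      \<comment> \<open>Any coordinate direction does; \<open>undefined\<close> picks one.\<close>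
      define i :: 'd where "i = undefined"
      have "((\<lambda>y. y + axis i 1) ^^ (2*N+1)) x $ i = x $ i + int (2*N+1)"
        by (rule funpow_add_axis)
      moreover have "x $ i \<ge> - int N" using x by (simp add: box_def)
      ultimately have "\<not> ((\<lambda>y. y + axis i 1) ^^ (2*N+1)) x $ i \<le> int N" by linarith
      then have "((\<lambda>y. y + axis i 1) ^^ (2*N+1)) x \<notin> ?\<Lambda>"
        unfolding box_def by blast
      from extend_sq_le[OF finite_box finite_lat_boundary[OF finite_box] axis_in_unit_steps x this, of psi phi]
      have "(extend ?\<Lambda> psi phi x)^2 \<le> 4^(2*N+1) * (?E + S)" unfolding S_def .
      moreover have "extend ?\<Lambda> psi phi x = phi x" using x by (simp add: extend_def)
      ultimately show "(phi x)^2 \<le> 4^(2*N+1) * (?E + S)" by metis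
    qed
    also have "\<dots> = c * (?E + S)" by (simp add: c_def)
    finally show ?thesis using c by (simp add: field_simps)
  qed
  then show ?thesis using c by (intro exI[of _ "1/c"] exI[of _ S]) simp
qed

section \<open>Integrability of the Boltzmann weight\<close>

lemma integrable_exp_quadratic:
  assumes "a > 0"
  shows "integrable lborel (\<lambda>t::real. exp (- a * t^2))"
proof -
  define s where "s = sqrt (1 / (2 * a))"
  have s: "s > 0" "s^2 = 1 / (2*a)" using assms by (auto simp: s_def)
  have "(\<lambda>t. sqrt (2 * pi * s\<^sup>2) * normal_density 0 s t) = (\<lambda>t. exp (- a * t^2))"
    using s assms by (auto simp: normal_density_def field_simps)
  moreover have "integrable lborel (\<lambda>t. sqrt (2 * pi * s\<^sup>2) * normal_density 0 s t)"
    using s by simp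
  ultimately show ?thesis by metis
qed

lemma borel_measurable_hamiltonian:
  fixes \<Lambda> :: "(int^'d) set"
  assumes V: "V \<in> borel_measurable borel"
  shows "hamiltonian V \<Lambda> psi xi \<in> borel_measurable (PiM \<Lambda> (\<lambda>_. lborel))"
proof -
  have f: "(\<lambda>phi. extend \<Lambda> psi phi x) \<in> borel_measurable (PiM \<Lambda> (\<lambda>_. lborel))" for x
  proof (cases "x \<in> \<Lambda>")
    case True
    then have "(\<lambda>phi. phi x) \<in> measurable (PiM \<Lambda> (\<lambda>_. lborel)) (lborel :: real measure)"
      by (rule measurable_component_singleton)
    then show ?thesis using True by (simp add: extend_def)
  qed (simp add: extend_def)
  have g: "(\<lambda>phi. V (extend \<Lambda> psi phi x - extend \<Lambda> psi phi y)) \<in> borel_measurable (PiM \<Lambda> (\<lambda>_. lborel))" for x y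
    using f by (intro measurable_compose[OF _ V]) auto
  have h: "(\<lambda>phi. \<Sum>x\<in>\<Lambda>. xi x * phi x) \<in> borel_measurable (PiM \<Lambda> (\<lambda>_. lborel))"
  proof (intro borel_measurable_sum borel_measurable_times)
    fix x assume x: "x \<in> \<Lambda>"
    show "(\<lambda>phi. phi x) \<in> borel_measurable (PiM \<Lambda> (\<lambda>_. lborel))"
      using f[of x] x by (simp add: extend_def)
  qed simp
  have s: "(\<lambda>phi. \<Sum>p\<in>P. V (extend \<Lambda> psi phi (fst p) - extend \<Lambda> psi phi (snd p)))
      \<in> borel_measurable (PiM \<Lambda> (\<lambda>_. lborel))" for P
    by (rule borel_measurable_sum) (rule g)
  have "hamiltonian V \<Lambda> psi xi = (\<lambda>phi.
     (1/2) * (\<Sum>p\<in>{(x,y). x \<in> \<Lambda> \<and> y \<in> \<Lambda> \<and> lat_adj x y}.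
        V (extend \<Lambda> psi phi (fst p) - extend \<Lambda> psi phi (snd p)))
     + (\<Sum>p\<in>{(x,y). x \<in> \<Lambda> \<and> y \<in> lat_boundary \<Lambda> \<and> lat_adj x y}.
        V (extend \<Lambda> psi phi (fst p) - extend \<Lambda> psi phi (snd p)))
     + (1/2) * (\<Sum>x\<in>\<Lambda>. xi x * phi x))"
    by (rule ext) (rule hamiltonian_eq)
  then show ?thesis
    by (simp only:) (intro borel_measurable_add borel_measurable_times borel_measurable_const s h)
qed

text \<open>Coercivity beats the linear disorder term and leaves a product of Gaussians as
  dominating function. Without integrability the Bochner integral would be zero by convention, and
  no lower bound on \<open>partition_fn\<close> could hold.\<close>

lemma integrable_exp_hamiltonian:
  fixes psi xi :: "int^'d \<Rightarrow> real"
  assumes V: "V \<in> borel_measurable borel" and A: "A > 0" and low: "\<And>s. V s \<ge> A * s^2 - B"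
  shows "integrable (PiM (box N) (\<lambda>_. lborel)) (\<lambda>phi. exp (- hamiltonian V (box N) psi xi phi))"
proof -
  let ?\<Lambda> = "box N :: (int^'d) set"
  let ?M = "PiM ?\<Lambda> (\<lambda>_. lborel :: real measure)"
  obtain \<kappa> S where \<kappa>: "\<kappa> > 0"
    and coer: "\<And>phi. (\<Sum>p\<in>edges ?\<Lambda>. (extend ?\<Lambda> psi phi (fst p) - extend ?\<Lambda> psi phi (snd p))^2)
       \<ge> \<kappa> * (\<Sum>x\<in>?\<Lambda>. (phi x)^2) - S"
    using dirichlet_coercive_box[of N psi] by blast
  \<comment> \<open>The quadratic part of the lower bound has coefficient \<open>a\<close> per site.
    Half of it is spent on completing the square against the disorder, at the price
    \<open>(xi x)^2 / (8 * a)\<close>.\<close>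
  define a where "a = A * \<kappa> / 2"
  have a: "a > 0" using A \<kappa> by (simp add: a_def)
  define K where "K = A * S / 2 + \<bar>B\<bar> * card (edges ?\<Lambda>) + (\<Sum>x\<in>?\<Lambda>. (xi x)^2 / (8 * a))"
  have H: "hamiltonian V ?\<Lambda> psi xi phi \<ge> (a/2) * (\<Sum>x\<in>?\<Lambda>. (phi x)^2) - K" for phi
  proof -
    let ?E = "(\<Sum>p\<in>edges ?\<Lambda>. (extend ?\<Lambda> psi phi (fst p) - extend ?\<Lambda> psi phi (snd p))^2)"
    have "V s \<ge> A * s^2 - \<bar>B\<bar>" for s using low[of s] by linarith
    then have "hamiltonian V ?\<Lambda> psi xi phi \<ge> (1/2) * (A * ?E)
      - \<bar>B\<bar> * real (card (edges ?\<Lambda>)) + (1/2) * (\<Sum>x\<in>?\<Lambda>. xi x * phi x)"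
      using hamiltonian_lower[of ?\<Lambda> "\<lambda>s. A * s^2" "\<bar>B\<bar>" V psi phi xi] A
      by (simp add: sum_distrib_left)
    moreover have "A * ?E \<ge> A * (\<kappa> * (\<Sum>x\<in>?\<Lambda>. (phi x)^2) - S)"
      using coer[of phi] A by (intro mult_left_mono) auto
    moreover have "(1/2) * (\<Sum>x\<in>?\<Lambda>. xi x * phi x) \<ge> - (a/2) * (\<Sum>x\<in>?\<Lambda>. (phi x)^2) - (\<Sum>x\<in>?\<Lambda>. (xi x)^2 / (8 * a))"
    proof -
      have "(1/2) * (xi x * phi x) \<ge> - (a/2) * (phi x)^2 - (xi x)^2 / (8 * a)" for x
      proof -
        have "0 \<le> (2 * a * phi x + xi x)^2 / (8 * a)" using a by simp
        also have "\<dots> = (a/2) * (phi x)^2 + (1/2) * (xi x * phi x) + (xi x)^2 / (8 * a)"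
          using a by (simp add: power2_eq_square field_simps)
        finally show ?thesis by simp
      qed
      then have "(\<Sum>x\<in>?\<Lambda>. (1/2) * (xi x * phi x)) \<ge> (\<Sum>x\<in>?\<Lambda>. - (a/2) * (phi x)^2 - (xi x)^2 / (8 * a))"
        by (intro sum_mono)
      then show ?thesis by (simp only: sum_subtractf sum_distrib_left)
    qed
    ultimately show ?thesis unfolding K_def a_def by (simp add: algebra_simps)
  qed
  interpret product_sigma_finite "\<lambda>_::int^'d. lborel :: real measure" by standard
  have dom: "integrable ?M (\<lambda>phi. exp K * (\<Prod>x\<in>?\<Lambda>. exp (- (a/2) * (phi x)^2)))"
    using a by (intro integrable_mult_right product_integrable_prod integrable_exp_quadratic) auto
  show ?thesis
  proof (rule Bochner_Integration.integrable_bound[OF dom])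
    show "(\<lambda>phi. exp (- hamiltonian V ?\<Lambda> psi xi phi)) \<in> borel_measurable ?M"
      using borel_measurable_hamiltonian[OF V, of "box N" psi xi] by measurable
    show "AE phi in ?M. norm (exp (- hamiltonian V ?\<Lambda> psi xi phi)) \<le> norm (exp K * (\<Prod>x\<in>?\<Lambda>. exp (- (a/2) * (phi x)^2)))"
    proof (rule AE_I2)
      fix phi
      have "exp K * (\<Prod>x\<in>?\<Lambda>. exp (- (a/2) * (phi x)^2)) = exp (K - (a/2) * (\<Sum>x\<in>?\<Lambda>. (phi x)^2))"
        unfolding sum_distrib_left diff_conv_add_uminus exp_add sum_negf[symmetric]
        by (subst exp_sum) simp_all
      then show "norm (exp (- hamiltonian V ?\<Lambda> psi xi phi)) \<le> norm (exp K * (\<Prod>x\<in>?\<Lambda>. exp (- (a/2) * (phi x)^2)))"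
        using H[of phi] by simp
    qed
  qed
qed

text \<open>The weight is at least \<open>exp (- K)\<close> on the cube of side one centred at
  \<open>f\<close>; that cube has volume one, so it contributes no further factor.\<close>

lemma ln_partition_fn_ge:
  fixes psi xi f :: "int^'d \<Rightarrow> real"
  assumes V: "V \<in> borel_measurable borel" and A: "A > 0" and low: "\<And>s. V s \<ge> A * s^2 - B"
    and H: "\<And>phi. (\<And>x. x \<in> box N \<Longrightarrow> \<bar>phi x - f x\<bar> \<le> 1/2) \<Longrightarrow> hamiltonian V (box N) psi xi phi \<le> K"
  shows "ln (partition_fn V (box N) psi xi) \<ge> - K"
proof -
  let ?\<Lambda> = "box N :: (int^'d) set"
  let ?M = "PiM ?\<Lambda> (\<lambda>_. lborel :: real measure)"
  interpret product_sigma_finite "\<lambda>_::int^'d. lborel :: real measure" by standard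
  define Q where "Q = (\<Pi>\<^sub>E x\<in>?\<Lambda>. {f x - 1/2..f x + 1/2})"
  have Q: "Q \<in> sets ?M" unfolding Q_def by (intro sets_PiM_I_finite) auto
  have "emeasure ?M Q = (\<Prod>x\<in>?\<Lambda>. emeasure lborel {f x - 1/2..f x + 1/2})"
    unfolding Q_def by (intro emeasure_PiM) auto
  then have eQ: "emeasure ?M Q = 1" by simp
  then have mQ: "measure ?M Q = 1" by (simp add: measure_def)
  have "exp (- K) = (\<integral>phi. indicator Q phi * exp (- K) \<partial>?M)"
    using mQ Q by simp
  also have "\<dots> \<le> (\<integral>phi. exp (- hamiltonian V ?\<Lambda> psi xi phi) \<partial>?M)"
  proof (rule integral_mono)
    show "integrable ?M (\<lambda>phi. indicator Q phi * exp (- K))"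
      using eQ Q by (intro integrable_mult_left integrable_real_indicator) auto
    show "integrable ?M (\<lambda>phi. exp (- hamiltonian V ?\<Lambda> psi xi phi))"
      by (rule integrable_exp_hamiltonian[OF V A low])
    fix phi
    show "indicator Q phi * exp (- K) \<le> exp (- hamiltonian V ?\<Lambda> psi xi phi)"
    proof (cases "phi \<in> Q")
      case True
      have "\<bar>phi x - f x\<bar> \<le> 1/2" if "x \<in> ?\<Lambda>" for x
      proof -
        have "phi x \<in> {f x - 1/2..f x + 1/2}" using True that unfolding Q_def by (rule PiE_mem)
        then have "f x - 1/2 \<le> phi x" "phi x \<le> f x + 1/2" by auto
        then show ?thesis by linarith
      qed
      then show ?thesis using H[of phi] True by simp
    qed simp
  qed
  finally have "exp (- K) \<le> partition_fn V ?\<Lambda> psi xi" by (simp add: partition_fn_def)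
  moreover from this have "partition_fn V ?\<Lambda> psi xi > 0"
    using exp_gt_zero[of "-K"] by linarith
  ultimately show ?thesis by (simp add: ln_ge_iff)
qed

text \<open>The Dirichlet energy in the counting of \<open>edges\<close>: inner edges twice,
  boundary edges once.\<close>

definition energy :: "nat \<Rightarrow> (int^'d \<Rightarrow> real) \<Rightarrow> real" where
  "energy N h = (\<Sum>x\<in>box N. \<Sum>z\<in>unit_steps. (h x - h (x + z))^2)"

text \<open>Near \<open>tilt u + h\<close> each gradient is the sum of a tilt increment, an
  increment of \<open>h\<close> and a cube error of size at most one; \<open>sq_add3_le\<close>
  separates them. The first and the third cost a constant per site, collected in \<open>c\<close>
  together with the offset \<open>b\<close>.\<close>

lemma surface_tension_le:
  fixes u :: "real^'d" and h xi :: "int^'d \<Rightarrow> real"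
  assumes V: "V \<in> borel_measurable borel" and A: "A > 0" and low: "\<And>s. V s \<ge> A * s^2 - B"
    and up: "\<And>s. V s \<le> b + C * s^2" and b: "b \<ge> 0" and C: "C \<ge> 0"
    and h: "\<And>x. x \<notin> box N \<Longrightarrow> h x = 0"
  defines "n \<equiv> real (card (box N :: (int^'d) set))"
  defines "c \<equiv> real (card (unit_steps :: (int^'d) set)) * (b + 3 * C * ((\<Sum>i\<in>UNIV. \<bar>u$i\<bar>)^2 + 1))"
  shows "surface_tension V N xi u \<le> c + (3 * C * energy N h + (\<Sum>x\<in>box N. xi x * tilt u x) / 2
     + (\<Sum>x\<in>box N. xi x * h x) / 2 + (\<Sum>x\<in>box N. \<bar>xi x\<bar>) / 4) / n"
proof -
  let ?\<Lambda> = "box N :: (int^'d) set"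
  define U where "U = (\<Sum>i\<in>UNIV. \<bar>u$i\<bar>)"
  define K where "K = n * c + (3 * C * energy N h + (\<Sum>x\<in>?\<Lambda>. xi x * tilt u x) / 2
     + (\<Sum>x\<in>?\<Lambda>. xi x * h x) / 2 + (\<Sum>x\<in>?\<Lambda>. \<bar>xi x\<bar>) / 4)"
  have n: "n > 0" using card_box_pos[of N, where 'd='d] by (simp add: n_def)
  have "- K \<le> ln (partition_fn V ?\<Lambda> (tilt u) xi)"
  proof (rule ln_partition_fn_ge[OF V A low, where f = "\<lambda>x. tilt u x + h x"])
    fix phi assume phi: "\<And>x. x \<in> ?\<Lambda> \<Longrightarrow> \<bar>phi x - (tilt u x + h x)\<bar> \<le> 1/2"
    define g where "g = extend ?\<Lambda> (tilt u) phi"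
    \<comment> \<open>Valid off the box too, where the extended field is the tilt and
      \<open>h\<close> vanishes. Hence boundary edges are treated like inner ones.\<close>
    have eps: "\<bar>g x - (tilt u x + h x)\<bar> \<le> 1/2" for x
      using phi[of x] h[of x] by (auto simp: g_def extend_def)
    have "(\<Sum>x\<in>?\<Lambda>. \<Sum>z\<in>unit_steps. b + C * (g x - g (x + z))^2)
       \<le> (\<Sum>x\<in>?\<Lambda>. \<Sum>z\<in>unit_steps. (b + 3 * C * (U^2 + 1)) + 3 * C * (h x - h (x + z))^2)"
    proof (intro sum_mono)
      fix x z :: "int^'d" assume z: "z \<in> unit_steps"
      have tz: "\<bar>tilt u z\<bar> \<le> U"
        using abs_tilt_le[of z 1 u] unit_steps_sup_norm[OF z] by (simp add: U_def sup_norm_le_iff)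
      define e where "e = (g x - (tilt u x + h x)) - (g (x+z) - (tilt u (x+z) + h (x+z)))"
      have e: "\<bar>e\<bar> \<le> 1" using eps[of x] eps[of "x+z"] unfolding e_def by linarith
      have "g x - g (x + z) = (- tilt u z) + (h x - h (x + z)) + e"
        by (simp add: e_def tilt_add)
      then have "(g x - g (x + z))^2 \<le> 3 * ((- tilt u z)^2 + (h x - h (x + z))^2 + e^2)"
        by (simp only: sq_add3_le)
      also have "\<dots> \<le> 3 * (U^2 + (h x - h (x + z))^2 + 1)"
      proof -
        have "(- tilt u z)^2 \<le> U^2" using tz by (metis abs_le_square_iff abs_minus_cancel abs_of_nonneg abs_ge_zero order_trans)
        moreover have "e^2 \<le> 1" using e by (simp add: abs_square_le_1)
        ultimately show ?thesis by simp
      qed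
      finally have "C * (g x - g (x + z))^2 \<le> C * (3 * (U^2 + (h x - h (x + z))^2 + 1))"
        using C by (intro mult_left_mono)
      then show "b + C * (g x - g (x + z))^2 \<le> (b + 3 * C * (U^2 + 1)) + 3 * C * (h x - h (x + z))^2"
        by (simp add: algebra_simps)
    qed
    also have "\<dots> = n * c + 3 * C * energy N h"
      by (simp add: sum.distrib n_def c_def energy_def sum_distrib_left U_def)
    finally have 1: "(\<Sum>x\<in>?\<Lambda>. \<Sum>z\<in>unit_steps. b + C * (g x - g (x + z))^2) \<le> n * c + 3 * C * energy N h" .
    have "(\<Sum>x\<in>?\<Lambda>. xi x * phi x) \<le> (\<Sum>x\<in>?\<Lambda>. xi x * tilt u x + xi x * h x + \<bar>xi x\<bar> / 2)"
    proof (rule sum_mono)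
      fix x assume "x \<in> ?\<Lambda>"
      have "xi x * (phi x - (tilt u x + h x)) \<le> \<bar>xi x\<bar> * \<bar>phi x - (tilt u x + h x)\<bar>"
        by (metis abs_ge_self abs_mult)
      also have "\<dots> \<le> \<bar>xi x\<bar> * (1/2)" using phi[OF \<open>x \<in> ?\<Lambda>\<close>] by (intro mult_left_mono) auto
      finally show "xi x * phi x \<le> xi x * tilt u x + xi x * h x + \<bar>xi x\<bar> / 2"
        by (simp add: algebra_simps)
    qed
    also have "\<dots> = (\<Sum>x\<in>?\<Lambda>. xi x * tilt u x) + (\<Sum>x\<in>?\<Lambda>. xi x * h x) + (\<Sum>x\<in>?\<Lambda>. \<bar>xi x\<bar>) / 2"
      by (simp add: sum.distrib sum_divide_distrib)
    finally have 2: "(\<Sum>x\<in>?\<Lambda>. xi x * phi x) \<le> (\<Sum>x\<in>?\<Lambda>. xi x * tilt u x) + (\<Sum>x\<in>?\<Lambda>. xi x * h x) + (\<Sum>x\<in>?\<Lambda>. \<bar>xi x\<bar>) / 2" .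
    have "hamiltonian V ?\<Lambda> (tilt u) xi phi \<le> (\<Sum>x\<in>?\<Lambda>. \<Sum>z\<in>unit_steps. b + C * (g x - g (x + z))^2)
      + (1/2) * (\<Sum>x\<in>?\<Lambda>. xi x * phi x)"
      unfolding g_def by (rule hamiltonian_upper) (use up b C in auto)
    with 1 2 show "hamiltonian V ?\<Lambda> (tilt u) xi phi \<le> K" unfolding K_def by simp
  qed
  then have "(1 / n) * - ln (partition_fn V ?\<Lambda> (tilt u) xi) \<le> (1 / n) * K"
    using n by (intro mult_left_mono) auto
  then show ?thesis using n
    unfolding surface_tension_def n_def[symmetric] K_def by (simp add: add_divide_distrib)
qed

section \<open>A truncated Green function\<close>

text \<open>A radial profile that drops by \<open>1 / (r + 1)^(d - 1)\<close> from radius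
  \<open>r\<close> to \<open>r + 1\<close>, the decay of the gradient of the Green function, and is
  cut to zero at radius \<open>R\<close>. For \<open>sup_norm z \<le> R\<close> it is
  \<open>R - sup_norm z\<close> in dimension one and a difference of harmonic numbers in dimension
  two.\<close>

definition green :: "nat \<Rightarrow> int^'d \<Rightarrow> real" where
  "green R z = (\<Sum>r=sup_norm z..<R. 1 / real (Suc r) ^ (CARD('d) - 1))"

lemma green_nonneg: "green R z \<ge> 0"
  unfolding green_def by (intro sum_nonneg) auto

lemma green_le: "green R (z :: int^'d) \<le> green R (0 :: int^'d)"
  unfolding green_def by (intro sum_mono2) auto

lemma green_eq_0: "R \<le> sup_norm z \<Longrightarrow> green R z = 0"
  by (simp add: green_def)

lemma green_uminus: "green R (- z) = green R z"
  by (simp add: green_def sup_norm_uminus)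

lemma green_0_ge_1:
  assumes "R \<ge> 1"
  shows "green R (0 :: int^'d) \<ge> 1"
proof -
  have "1 / real (Suc 0) ^ (CARD('d) - 1) \<le> green R (0 :: int^'d)"
    unfolding green_def by (intro member_le_sum) (use assms in auto)
  then show ?thesis by simp
qed

text \<open>Radii that differ by at most one give sums that differ by at most one term; from
  \<open>R\<close> on both sums are empty.\<close>

lemma green_diff_le:
  fixes v w :: "int^'d"
  assumes vw: "sup_norm v \<le> sup_norm w" "sup_norm w \<le> Suc (sup_norm v)"
  shows "\<bar>green R v - green R w\<bar> \<le> 1 / real (Suc (sup_norm v)) ^ (CARD('d) - 1)"
proof (cases "sup_norm v = sup_norm w")
  case True
  then show ?thesis by (simp add: green_def)
next
  case False
  then have w: "sup_norm w = Suc (sup_norm v)" using vw by linarith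
  show ?thesis
  proof (cases "sup_norm v < R")
    case True
    then have "green R v = 1 / real (Suc (sup_norm v)) ^ (CARD('d) - 1) + green R w"
      unfolding green_def w by (rule sum.atLeast_Suc_lessThan)
    then show ?thesis by simp
  next
    case False
    then show ?thesis using w by (simp add: green_eq_0)
  qed
qed

text \<open>An outward step is controlled at the radius of \<open>w\<close>, an inward step at a
  radius smaller by one. The factor 2 converts the latter, because
  \<open>n + 2 \<le> 2 * (n + 1)\<close> and the exponent \<open>d - 1\<close> is at most
  one.\<close>

lemma green_step_sq_le:
  fixes w z :: "int^'d"
  assumes d: "CARD('d) \<in> {1, 2}" and z: "z \<in> unit_steps"
  shows "(green R w - green R (w + z))^2 \<le> 4 / real (Suc (sup_norm w)) ^ (2 * (CARD('d) - 1))"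
proof -
  let ?p = "CARD('d) - 1"
  have "\<bar>green R w - green R (w + z)\<bar> \<le> 2 / real (Suc (sup_norm w)) ^ ?p"
  proof (cases "sup_norm w \<le> sup_norm (w + z)")
    case True
    have "\<bar>green R w - green R (w + z)\<bar> \<le> 1 / real (Suc (sup_norm w)) ^ ?p"
      by (rule green_diff_le[OF True sup_norm_step_le[OF z]])
    also have "\<dots> \<le> 2 / real (Suc (sup_norm w)) ^ ?p" by (intro divide_right_mono) auto
    finally show ?thesis .
  next
    case False
    then have e: "sup_norm w = Suc (sup_norm (w + z))" using sup_norm_step_ge[OF z, of w] by linarith
    have "\<bar>green R (w + z) - green R w\<bar> \<le> 1 / real (Suc (sup_norm (w + z))) ^ ?p"
      by (rule green_diff_le) (use e in auto)
    also have "\<dots> \<le> 2 / real (Suc (sup_norm w)) ^ ?p"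
      using d unfolding e by (auto simp: field_simps)
    finally show ?thesis by (simp add: abs_minus_commute)
  qed
  then have "\<bar>green R w - green R (w + z)\<bar>^2 \<le> (2 / real (Suc (sup_norm w)) ^ ?p)^2"
    by (intro power_mono) auto
  then show ?thesis by (simp add: power_divide power_mult[symmetric] mult.commute)
qed

text \<open>As a difference of two boxes, a sphere of radius \<open>n \<ge> 1\<close> has two points
  in dimension one and \<open>8 * n\<close> in dimension two.\<close>

lemma card_sphere_le:
  assumes d: "CARD('d) \<in> {1, 2}"
  shows "real (card {w :: int^'d. sup_norm w = n}) \<le> 8 * real (Suc n) ^ (CARD('d) - 1)"
proof (cases n)
  case 0
  have "{w :: int^'d. sup_norm w = 0} = box 0" using sup_norm_le_iff[of _ 0] by auto
  then show ?thesis using 0 by (simp add: card_box)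
next
  case (Suc m)
  have "{w :: int^'d. sup_norm w = n} = box n - box m"
    using Suc by (auto simp: sup_norm_le_iff[symmetric])
  then have "card {w :: int^'d. sup_norm w = n} = card (box n :: (int^'d) set) - card (box m :: (int^'d) set)"
  proof -
    have "(box m :: (int^'d) set) \<subseteq> box n" using Suc by (intro box_mono) simp
    then show ?thesis using \<open>{w. sup_norm w = n} = box n - box m\<close> by (simp add: card_Diff_subset)
  qed
  also have "\<dots> = (2 * n + 1) ^ CARD('d) - (2 * m + 1) ^ CARD('d)" by (simp add: card_box)
  finally have "card {w :: int^'d. sup_norm w = n} \<le> 8 * Suc n ^ (CARD('d) - 1)"
    using d Suc by (auto simp: power2_eq_square)
  then have "real (card {w :: int^'d. sup_norm w = n}) \<le> real (8 * Suc n ^ (CARD('d) - 1))"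
    by (simp only: of_nat_le_iff)
  then show ?thesis by simp
qed

text \<open>Sum over spheres: the sphere of radius \<open>n\<close> has order
  \<open>n^(d - 1)\<close> points, and the squared gradient there is of order
  \<open>n^(- 2 * (d - 1))\<close>. The product rebuilds the sum that defines
  \<open>green R 0\<close>.\<close>

lemma green_energy_le:
  assumes d: "CARD('d) \<in> {1, 2}" and R: "R \<ge> 1"
  shows "(\<Sum>w\<in>(box R :: (int^'d) set). \<Sum>z\<in>unit_steps. (green R w - green R (w + z))^2)
    \<le> 64 * real (card (unit_steps :: (int^'d) set)) * green R (0 :: int^'d)"
proof -
  let ?D = "real (card (unit_steps :: (int^'d) set))" and ?p = "CARD('d) - 1"
  let ?B = "box R :: (int^'d) set"
  have "(\<Sum>w\<in>?B. 1 / real (Suc (sup_norm w)) ^ (2 * ?p))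
     = (\<Sum>n\<le>R. \<Sum>w\<in>{w. w \<in> ?B \<and> sup_norm w = n}. 1 / real (Suc (sup_norm w)) ^ (2 * ?p))"
    by (rule sum.group[symmetric]) (auto simp: sup_norm_le_iff)
  also have "\<dots> = (\<Sum>n\<le>R. real (card {w :: int^'d. sup_norm w = n}) * (1 / real (Suc n) ^ (2 * ?p)))"
  proof (intro sum.cong refl)
    fix n assume "n \<in> {..R}"
    then have "{w. w \<in> ?B \<and> sup_norm w = n} = {w. sup_norm w = n}"
      by (auto simp: sup_norm_le_iff[symmetric])
    then show "(\<Sum>w\<in>{w. w \<in> ?B \<and> sup_norm w = n}. 1 / real (Suc (sup_norm w)) ^ (2 * ?p))
       = real (card {w :: int^'d. sup_norm w = n}) * (1 / real (Suc n) ^ (2 * ?p))" by simp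
  qed
  also have "\<dots> \<le> (\<Sum>n\<le>R. 8 * real (Suc n) ^ ?p * (1 / real (Suc n) ^ (2 * ?p)))"
    by (intro sum_mono mult_right_mono card_sphere_le d) auto
  also have "\<dots> = (\<Sum>n\<le>R. 1 / real (Suc n) ^ ?p) * 8"
    unfolding mult_2 power_add sum_distrib_right by (intro sum.cong) (auto simp: divide_simps)
  \<comment> \<open>The sum over \<open>n \<le> R\<close> has one term more than
    \<open>green R 0\<close>; that term is at most one, hence at most
    \<open>green R 0\<close>.\<close>
  also have "\<dots> \<le> (2 * green R (0 :: int^'d)) * 8"
  proof (rule mult_right_mono)
    have "(\<Sum>n\<le>R. 1 / real (Suc n) ^ ?p) = green R (0 :: int^'d) + 1 / real (Suc R) ^ ?p"
      unfolding green_def by (simp add: lessThan_Suc_atMost[symmetric] lessThan_atLeast0)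
    moreover have "1 / real (Suc R) ^ ?p \<le> 1" by (simp add: one_le_power)
    ultimately show "(\<Sum>n\<le>R. 1 / real (Suc n) ^ ?p) \<le> 2 * green R (0 :: int^'d)"
      using green_0_ge_1[OF R, where 'd='d] by linarith
  qed simp
  finally have S: "(\<Sum>w\<in>?B. 1 / real (Suc (sup_norm w)) ^ (2 * ?p)) \<le> 16 * green R (0 :: int^'d)"
    by simp
  have "(\<Sum>w\<in>?B. \<Sum>z\<in>unit_steps. (green R w - green R (w + z))^2)
     \<le> (\<Sum>w\<in>?B. \<Sum>z\<in>(unit_steps :: (int^'d) set). 4 / real (Suc (sup_norm w)) ^ (2 * ?p))"
    by (intro sum_mono green_step_sq_le d)
  also have "\<dots> = 4 * ?D * (\<Sum>w\<in>?B. 1 / real (Suc (sup_norm w)) ^ (2 * ?p))"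
    by (simp add: sum_distrib_left mult.commute)
  also have "\<dots> \<le> 4 * ?D * (16 * green R (0 :: int^'d))"
    by (intro mult_left_mono S) simp
  finally show ?thesis by (simp add: mult_ac)
qed

text \<open>After a shift by \<open>y\<close>, steps starting outside \<open>box R\<close>
  contribute nothing, so the shifted box may be replaced by \<open>box R\<close>. The bound is
  uniform in \<open>y\<close> and \<open>N\<close>.\<close>

lemma sum_green_steps_le:
  fixes y :: "int^'d"
  assumes d: "CARD('d) \<in> {1, 2}" and R: "R \<ge> 1"
  shows "(\<Sum>x\<in>box N. \<Sum>z\<in>unit_steps. (green R (x - y) - green R (x + z - y))^2)
    \<le> 64 * real (card (unit_steps :: (int^'d) set)) * green R (0 :: int^'d)"
proof -
  define F where "F w = (\<Sum>z\<in>unit_steps. (green R w - green R (w + z))^2)" for w :: "int^'d"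
  have F0: "F w \<ge> 0" for w unfolding F_def by (intro sum_nonneg) auto
  have Fz: "F w = 0" if "w \<notin> box R" for w
    unfolding F_def
  proof (rule sum.neutral, rule ballI)
    fix z :: "int^'d" assume z: "z \<in> unit_steps"
    have "R < sup_norm w" using that sup_norm_le_iff[of w R] by auto
    then have "R \<le> sup_norm w" "R \<le> sup_norm (w + z)" using sup_norm_step_ge[OF z, of w] by auto
    then show "(green R w - green R (w + z))^2 = 0" by (simp add: green_eq_0)
  qed
  have "(\<Sum>x\<in>box N. \<Sum>z\<in>unit_steps. (green R (x - y) - green R (x + z - y))^2) = (\<Sum>x\<in>box N. F (x - y))"
    unfolding F_def by (intro sum.cong refl) (simp add: algebra_simps)
  also have "\<dots> = (\<Sum>w\<in>(\<lambda>x. x - y) ` box N. F w)"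
    by (subst sum.reindex) (auto simp: inj_on_def)
  also have "\<dots> \<le> (\<Sum>w\<in>(\<lambda>x. x - y) ` box N \<union> box R. F w)"
    by (intro sum_mono2) (use F0 in auto)
  also have "\<dots> = (\<Sum>w\<in>box R. F w)"
    by (rule sum.mono_neutral_right) (use Fz in auto)
  also have "\<dots> \<le> 64 * real (card (unit_steps :: (int^'d) set)) * green R (0 :: int^'d)"
    unfolding F_def by (rule green_energy_le[OF d R])
  finally show ?thesis .
qed

text \<open>The same localisation to \<open>box R\<close>, where every value is at most the one at
  the origin.\<close>

lemma sum_green_sq_le:
  fixes y :: "int^'d"
  shows "(\<Sum>x\<in>box N. (green R (x - y))^2) \<le> real ((2 * R + 1) ^ CARD('d)) * (green R (0 :: int^'d))^2"
proof -
  have z: "green R w = 0" if "w \<notin> box R" for w :: "int^'d"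
    using that sup_norm_le_iff[of w R] by (intro green_eq_0) auto
  have "(\<Sum>x\<in>box N. (green R (x - y))^2) = (\<Sum>w\<in>(\<lambda>x. x - y) ` box N. (green R w)^2)"
    by (subst sum.reindex) (auto simp: inj_on_def)
  also have "\<dots> \<le> (\<Sum>w\<in>(\<lambda>x. x - y) ` box N \<union> box R. (green R w)^2)"
    by (intro sum_mono2) auto
  also have "\<dots> = (\<Sum>w\<in>(box R :: (int^'d) set). (green R w)^2)"
    by (rule sum.mono_neutral_right) (use z in auto)
  also have "\<dots> \<le> (\<Sum>w\<in>(box R :: (int^'d) set). (green R (0 :: int^'d))^2)"
    by (intro sum_mono power_mono green_le green_nonneg)
  finally show ?thesis by (simp add: card_box)
qed

text \<open>The value at the origin is \<open>R\<close> in dimension one and the harmonic number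
  \<open>harm R\<close> in dimension two.\<close>

lemma filterlim_green_at_top:
  assumes "CARD('d) \<in> {1, 2}"
  shows "filterlim (\<lambda>R. green R (0 :: int^'d)) at_top sequentially"
proof (cases "CARD('d) = 1")
  case True
  then have "(\<lambda>R. green R (0 :: int^'d)) = real" by (auto simp: green_def)
  then show ?thesis by (simp add: filterlim_real_sequentially)
next
  case False
  then have "(\<lambda>R. green R (0 :: int^'d)) = harm"
    using assms by (auto simp: green_def harm_def fun_eq_iff atLeastLessThanSuc_atLeastAtMost
      sum.atLeast1_atMost_eq lessThan_atLeast0 field_simps)
  then show ?thesis by (simp add: harm_at_top)
qed

text \<open>\<open>N = m\<^sup>4\<close> and \<open>R = m\<^sup>3\<close> serve both dimensions: \<open>R\<close> is of smaller order than \<open>N\<close>, while in dimension one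
  \<open>green R 0 = R\<close> still dominates the order \<open>sqrt N\<close> of the tilt fluctuations.\<close>

lemma exists_scales:
  assumes d: "CARD('d) \<in> {1, 2}" and "\<epsilon> > 0"
  shows "\<exists>N R. 1 \<le> R \<and> R \<le> N \<and> green R (0 :: int^'d) \<ge> G
    \<and> real N ^ 2 \<le> \<epsilon> * (green R (0 :: int^'d))^2 * real (card (box N :: (int^'d) set))
    \<and> real ((2 * R + 1) ^ CARD('d)) \<le> \<epsilon> * real (card (box (N - R) :: (int^'d) set))
    \<and> real (card (box N :: (int^'d) set)) \<le> 4 * real (card (box (N - R) :: (int^'d) set))"
proof -
  define g where "g m = green (m^3) (0 :: int^'d)" for m
  have m3: "filterlim (\<lambda>m::nat. m^3) sequentially sequentially" by real_asymp
  have g: "filterlim g at_top sequentially"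
    unfolding g_def by (rule filterlim_compose[OF filterlim_green_at_top[OF d] m3])
  have e1: "\<forall>\<^sub>F m in sequentially. g m \<ge> G" using g by (simp add: filterlim_at_top)
  \<comment> \<open>With \<open>N = m^4\<close>, dimension one compares \<open>m^8\<close> with a
    multiple of \<open>m^6 * m^4\<close>. In dimension two the box already has more than
    \<open>N^2\<close> points, and the divergence of \<open>g\<close> takes care of
    \<open>\<epsilon>\<close>.\<close>
  have e2: "\<forall>\<^sub>F m in sequentially. real (m^4) ^ 2 \<le> \<epsilon> * (g m)^2 * real ((2 * m^4 + 1) ^ CARD('d))"
  proof (cases "CARD('d) = 1")
    case True
    then have "g m = real m ^ 3" for m by (simp add: g_def green_def)
    moreover have "\<forall>\<^sub>F m in sequentially. (real m^4)^2 \<le> \<epsilon> * (real m ^ 3)^2 * (1 + 2 * real m^4)"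
      using \<open>\<epsilon> > 0\<close> by real_asymp
    ultimately show ?thesis using True by simp
  next
    case False
    then have c: "CARD('d) = 2" using d by auto
    have "\<forall>\<^sub>F m in sequentially. g m \<ge> max 1 (1 / \<epsilon>)" using g unfolding filterlim_at_top by blast
    then show ?thesis
    proof (rule eventually_mono)
      fix m assume "g m \<ge> max 1 (1 / \<epsilon>)"
      then have g1: "g m \<ge> 1" "g m \<ge> 1 / \<epsilon>" by auto
      have "1 \<le> \<epsilon> * g m" using g1 \<open>\<epsilon> > 0\<close> by (simp add: field_simps)
      also have "\<dots> \<le> \<epsilon> * (g m)^2" using g1 \<open>\<epsilon> > 0\<close> by (simp add: power2_eq_square)
      finally have 1: "1 \<le> \<epsilon> * (g m)^2" .
      have "real (m^4) ^ 2 \<le> real (2 * m^4 + 1) ^ 2" by (intro power_mono) auto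
      also have "\<dots> \<le> \<epsilon> * (g m)^2 * real (2 * m^4 + 1) ^ 2"
        using mult_right_mono[OF 1, of "real (2 * m^4 + 1) ^ 2"] by simp
      finally show "real (m^4) ^ 2 \<le> \<epsilon> * (g m)^2 * real ((2 * m^4 + 1) ^ CARD('d))" by (simp add: c)
    qed
  qed
  have mle: "m^3 \<le> m^4" for m :: nat by (cases "m = 0") (auto intro: power_increasing)
  \<comment> \<open>Here \<open>R / N = 1 / m\<close> tends to zero, so a ball of radius
    \<open>R\<close> is negligible in volume against the inner box.\<close>
  have e3: "\<forall>\<^sub>F m in sequentially. real ((2 * m^3 + 1) ^ CARD('d)) \<le> \<epsilon> * real ((2 * (m^4 - m^3) + 1) ^ CARD('d))"
  proof -
    have "\<forall>\<^sub>F m in sequentially. (1 + 2 * real m^3) ^ CARD('d) \<le> \<epsilon> * (1 + (2 * real m^4 - 2 * real m^3)) ^ CARD('d)"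
      using d \<open>\<epsilon> > 0\<close> by (elim insertE emptyE; simp only:; real_asymp)
    then show ?thesis by (simp add: of_nat_diff mle)
  qed
  \<comment> \<open>The volume ratio tends to one, so the factor \<open>4\<close> leaves ample
    room.\<close>
  have e4: "\<forall>\<^sub>F m in sequentially. real ((2 * m^4 + 1) ^ CARD('d)) \<le> 4 * real ((2 * (m^4 - m^3) + 1) ^ CARD('d))"
  proof -
    have "\<forall>\<^sub>F m in sequentially. (1 + 2 * real m^4) ^ CARD('d) \<le> 4 * (1 + (2 * real m^4 - 2 * real m^3)) ^ CARD('d)"
      using d by (elim insertE emptyE; simp only:; real_asymp)
    then show ?thesis by (simp add: of_nat_diff mle)
  qed
  have "\<forall>\<^sub>F m in sequentially. (m::nat) \<ge> 1" by (rule eventually_ge_at_top)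
  with e1 e2 e3 e4 have "\<forall>\<^sub>F m in sequentially. m \<ge> 1 \<and> g m \<ge> G
      \<and> real (m^4) ^ 2 \<le> \<epsilon> * (g m)^2 * real ((2 * m^4 + 1) ^ CARD('d))
      \<and> real ((2 * m^3 + 1) ^ CARD('d)) \<le> \<epsilon> * real ((2 * (m^4 - m^3) + 1) ^ CARD('d))
      \<and> real ((2 * m^4 + 1) ^ CARD('d)) \<le> 4 * real ((2 * (m^4 - m^3) + 1) ^ CARD('d))"
    by eventually_elim blast
  then obtain m where "m \<ge> 1" "g m \<ge> G"
      "real (m^4) ^ 2 \<le> \<epsilon> * (g m)^2 * real ((2 * m^4 + 1) ^ CARD('d))"
      "real ((2 * m^3 + 1) ^ CARD('d)) \<le> \<epsilon> * real ((2 * (m^4 - m^3) + 1) ^ CARD('d))"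
      "real ((2 * m^4 + 1) ^ CARD('d)) \<le> 4 * real ((2 * (m^4 - m^3) + 1) ^ CARD('d))"
    using eventually_happens'[OF sequentially_bot] by blast
  then show ?thesis
    by (intro exI[of _ "m^4"] exI[of _ "m^3"]) (simp add: g_def card_box mle)
qed

section \<open>Second moments of independent fields\<close>

text \<open>Convergent sequences are bounded, so it suffices that almost surely every level
  \<open>- K\<close> is reached. The outcomes that miss a given level lie in bad sets of arbitrarily
  small probability, whose intersection is null; the index \<open>N\<close> may change with the
  level and with \<open>\<delta>\<close>.\<close>

lemma (in prob_space) AE_not_convergent_if_unbounded:
  fixes X :: "nat \<Rightarrow> 'a \<Rightarrow> real"
  assumes "\<And>K \<delta>. \<delta> > 0 \<Longrightarrow> \<exists>N. \<exists>B\<in>events. prob B \<le> \<delta> \<and> (\<forall>\<omega>\<in>space M - B. X N \<omega> \<le> - K)"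
  shows "AE \<omega> in M. \<not> convergent (\<lambda>N. X N \<omega>)"
proof -
  have *: "AE \<omega> in M. \<exists>N. X N \<omega> \<le> - real K" for K :: nat
  proof -
    have "\<exists>B\<in>events. prob B \<le> 1 / Suc m \<and> (\<forall>\<omega>\<in>space M - B. \<exists>N. X N \<omega> \<le> - real K)" for m
      using assms[of "1 / Suc m" "real K"] by fastforce
    then obtain B where B: "\<And>m. B m \<in> events" "\<And>m. prob (B m) \<le> 1 / Suc m"
      "\<And>m \<omega>. \<omega> \<in> space M - B m \<Longrightarrow> \<exists>N. X N \<omega> \<le> - real K" by metis
    define Z where "Z = (\<Inter>m. B m)"
    have Z: "Z \<in> events" unfolding Z_def using B(1) by auto
    have "prob Z \<le> 1 / Suc m" for m
    proof -
      have "prob Z \<le> prob (B m)" using B(1) by (intro finite_measure_mono) (auto simp: Z_def)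
      then show ?thesis using B(2)[of m] by linarith
    qed
    then have "prob Z \<le> 0"
      by (intro tendsto_lowerbound[OF LIMSEQ_Suc[OF lim_1_over_n]]) (auto simp: eventually_sequentially)
    then have "prob Z = 0" using measure_nonneg[of M Z] by linarith
    then have "Z \<in> null_sets M" using Z by (simp add: null_sets_def emeasure_eq_measure)
    then show ?thesis by (rule AE_I') (use B(3) in \<open>auto simp: Z_def\<close>)
  qed
  then have "AE \<omega> in M. \<forall>K. \<exists>N. X N \<omega> \<le> - real K" by (subst AE_all_countable) simp
  then show ?thesis
  proof (rule AE_mp, intro AE_I2 impI notI)
    fix \<omega> assume a: "\<forall>K. \<exists>N. X N \<omega> \<le> - real K" and c: "convergent (\<lambda>N. X N \<omega>)"
    from c have "Bseq (\<lambda>N. X N \<omega>)" by (rule convergent_imp_Bseq)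
    then obtain L where L: "\<And>N. \<bar>X N \<omega>\<bar> \<le> L" unfolding Bseq_def by auto
    obtain K :: nat where "L < real K" using reals_Archimedean2 by blast
    moreover obtain N where "X N \<omega> \<le> - real K" using a by blast
    ultimately show False using L[of N] by linarith
  qed
qed

lemma (in prob_space) markov_le:
  assumes "integrable M u" "\<And>\<omega>. 0 \<le> u \<omega>" "c > 0" "expectation u \<le> e"
  shows "prob {\<omega>\<in>space M. u \<omega> \<ge> c} \<le> e / c"
proof -
  have "prob {\<omega>\<in>space M. u \<omega> \<ge> c} \<le> expectation u / c"
    using assms by (intro integral_Markov_inequality_measure[where A="{}"]) auto
  also have "\<dots> \<le> e / c" using assms by (intro divide_right_mono) auto
  finally show ?thesis .
qed

section \<open>Independent identically distributed families\<close>

locale iid_family = prob_space M for M :: "'w measure" +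
  fixes xi :: "'w \<Rightarrow> 'i \<Rightarrow> real"
  assumes meas: "\<And>x. (\<lambda>\<omega>. xi \<omega> x) \<in> borel_measurable M"
    and indep: "indep_vars (\<lambda>_. borel) (\<lambda>x \<omega>. xi \<omega> x) UNIV"
    and ident: "\<And>x y. distr M borel (\<lambda>\<omega>. xi \<omega> x) = distr M borel (\<lambda>\<omega>. xi \<omega> y)"
begin

declare meas [measurable]

lemma meas_comp:
  "f \<in> borel_measurable borel \<Longrightarrow> (\<lambda>\<omega>. f (xi \<omega> x)) \<in> borel_measurable M"
  by (rule measurable_compose[OF meas])

lemma integrable_ident:
  fixes f :: "real \<Rightarrow> real"
  assumes f: "f \<in> borel_measurable borel" and "integrable M (\<lambda>\<omega>. f (xi \<omega> x))"
  shows "integrable M (\<lambda>\<omega>. f (xi \<omega> y))"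
  using assms(2) integrable_distr_eq[OF meas f] ident[of x y] by metis

lemma expectation_ident:
  fixes f :: "real \<Rightarrow> real"
  assumes f: "f \<in> borel_measurable borel"
  shows "expectation (\<lambda>\<omega>. f (xi \<omega> x)) = expectation (\<lambda>\<omega>. f (xi \<omega> y))"
  using integral_distr[OF meas f] ident[of x y] by metis

lemma
  fixes f :: "'i \<Rightarrow> real \<Rightarrow> real"
  assumes "finite J" and f: "\<And>s. s \<in> J \<Longrightarrow> f s \<in> borel_measurable borel"
    and int: "\<And>s. s \<in> J \<Longrightarrow> integrable M (\<lambda>\<omega>. f s (xi \<omega> s))"
  shows expectation_prod: "expectation (\<lambda>\<omega>. \<Prod>s\<in>J. f s (xi \<omega> s)) = (\<Prod>s\<in>J. expectation (\<lambda>\<omega>. f s (xi \<omega> s)))"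
    and integrable_prod: "integrable M (\<lambda>\<omega>. \<Prod>s\<in>J. f s (xi \<omega> s))"
proof -
  have "indep_vars (\<lambda>_. borel) (\<lambda>s \<omega>. f s (xi \<omega> s)) J"
    by (rule indep_vars_compose2[OF indep_vars_subset[OF indep subset_UNIV] f])
  then show "expectation (\<lambda>\<omega>. \<Prod>s\<in>J. f s (xi \<omega> s)) = (\<Prod>s\<in>J. expectation (\<lambda>\<omega>. f s (xi \<omega> s)))"
    "integrable M (\<lambda>\<omega>. \<Prod>s\<in>J. f s (xi \<omega> s))"
    using assms by (auto intro!: indep_vars_lebesgue_integral indep_vars_integrable)
qed

text \<open>Expand the square: distinct sites are uncorrelated by independence and centring, and
  equal sites share one variance.\<close>

lemma
  fixes f :: "real \<Rightarrow> real" and w :: "'i \<Rightarrow> real"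
  assumes f: "f \<in> borel_measurable borel"
    and sq: "integrable M (\<lambda>\<omega>. (f (xi \<omega> x0))^2)"
    and mean: "expectation (\<lambda>\<omega>. f (xi \<omega> x0)) = 0"
    and fin: "finite S"
  shows integrable_weighted_sum_sq: "integrable M (\<lambda>\<omega>. (\<Sum>x\<in>S. w x * f (xi \<omega> x))^2)"
    and expectation_weighted_sum_sq:
      "expectation (\<lambda>\<omega>. (\<Sum>x\<in>S. w x * f (xi \<omega> x))^2) = expectation (\<lambda>\<omega>. (f (xi \<omega> x0))^2) * (\<Sum>x\<in>S. (w x)^2)"
proof -
  let ?v = "expectation (\<lambda>\<omega>. (f (xi \<omega> x0))^2)"
  have f2: "(\<lambda>t. (f t)^2) \<in> borel_measurable borel" using f by measurable
  have sqi: "integrable M (\<lambda>\<omega>. (f (xi \<omega> x))^2)" for x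
    by (rule integrable_ident[OF f2 sq])
  have fi: "integrable M (\<lambda>\<omega>. f (xi \<omega> x))" for x
    by (rule square_integrable_imp_integrable[OF meas_comp[OF f] sqi])
  have pair: "integrable M (\<lambda>\<omega>. f (xi \<omega> x) * f (xi \<omega> y)) \<and>
      expectation (\<lambda>\<omega>. f (xi \<omega> x) * f (xi \<omega> y)) = (if x = y then ?v else 0)" for x y
  proof (cases "x = y")
    case True
    then show ?thesis using sqi[of y] expectation_ident[OF f2, of y x0] by (simp add: power2_eq_square)
  next
    case False
    have "expectation (\<lambda>\<omega>. f (xi \<omega> x)) = 0" using expectation_ident[OF f, of x x0] mean by simp
    then show ?thesis
      using expectation_prod[of "{x,y}" "\<lambda>_. f"] integrable_prod[of "{x,y}" "\<lambda>_. f"] False f fi by simp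
  qed
  have eq: "(\<Sum>x\<in>S. w x * f (xi \<omega> x))^2 = (\<Sum>x\<in>S. \<Sum>y\<in>S. w x * w y * (f (xi \<omega> x) * f (xi \<omega> y)))" for \<omega>
    by (simp add: power2_eq_square sum_product algebra_simps)
  show "integrable M (\<lambda>\<omega>. (\<Sum>x\<in>S. w x * f (xi \<omega> x))^2)"
    unfolding eq using pair by (intro Bochner_Integration.integrable_sum integrable_mult_right) auto
  have "expectation (\<lambda>\<omega>. (\<Sum>x\<in>S. w x * f (xi \<omega> x))^2) = (\<Sum>x\<in>S. \<Sum>y\<in>S. w x * w y * (if x = y then ?v else 0))"
    unfolding eq using pair
    by (subst Bochner_Integration.integral_sum, intro Bochner_Integration.integrable_sum integrable_mult_right, simp)
       (intro sum.cong refl, subst Bochner_Integration.integral_sum, auto intro: integrable_mult_right)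
  also have "\<dots> = ?v * (\<Sum>x\<in>S. (w x)^2)"
  proof -
    have "(\<Sum>y\<in>S. w x * w y * (if x = y then ?v else 0)) = ?v * (w x)^2" if "x \<in> S" for x
    proof -
      have "(\<Sum>y\<in>S. w x * w y * (if x = y then ?v else 0)) = (\<Sum>y\<in>S. if x = y then ?v * (w y)^2 else 0)"
        by (intro sum.cong) (auto simp: power2_eq_square)
      then show ?thesis using fin that by simp
    qed
    then show ?thesis by (simp add: sum_distrib_left)
  qed
  finally show "expectation (\<lambda>\<omega>. (\<Sum>x\<in>S. w x * f (xi \<omega> x))^2) = ?v * (\<Sum>x\<in>S. (w x)^2)" .
qed

text \<open>Expand the square over pairs \<open>p\<close> and \<open>q\<close>. Unless
  \<open>q\<close> is \<open>p\<close> or its swap, some site carries a single centred factor and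
  independence kills the term, so at most two terms per \<open>p\<close> survive. Boundedness of
  \<open>g\<close> makes second moments of \<open>f\<close> suffice although every term has four
  factors.\<close>

lemma
  fixes f g :: "real \<Rightarrow> real" and k :: "'i \<Rightarrow> 'i \<Rightarrow> real"
  assumes f: "f \<in> borel_measurable borel" and g: "g \<in> borel_measurable borel"
    and sq: "integrable M (\<lambda>\<omega>. (f (xi \<omega> x0))^2)"
    and mean_f: "expectation (\<lambda>\<omega>. f (xi \<omega> x0)) = 0"
    and mean_g: "expectation (\<lambda>\<omega>. g (xi \<omega> x0)) = 0"
    and bound: "\<And>t. \<bar>g t\<bar> \<le> c"
    and fin: "finite P" and off: "\<And>x y. (x, y) \<in> P \<Longrightarrow> x \<noteq> y"
    and sym: "\<And>x y. k x y = k y x"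
  shows integrable_offdiagonal_sum_sq:
      "integrable M (\<lambda>\<omega>. (\<Sum>(x,y)\<in>P. k x y * (f (xi \<omega> x) * g (xi \<omega> y)))^2)"
    and expectation_offdiagonal_sum_sq_le:
      "expectation (\<lambda>\<omega>. (\<Sum>(x,y)\<in>P. k x y * (f (xi \<omega> x) * g (xi \<omega> y)))^2)
        \<le> 2 * c^2 * expectation (\<lambda>\<omega>. (f (xi \<omega> x0))^2) * (\<Sum>(x,y)\<in>P. (k x y)^2)"
proof -
  let ?v = "expectation (\<lambda>\<omega>. (f (xi \<omega> x0))^2)"
  define X where "X p \<omega> = f (xi \<omega> (fst p)) * g (xi \<omega> (snd p))" for p \<omega>
  define kk where "kk p = k (fst p) (snd p)" for p
  have f2: "(\<lambda>t. (f t)^2) \<in> borel_measurable borel" using f by measurable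
  have c0: "c \<ge> 0" using bound[of 0] by linarith
  have sqi: "integrable M (\<lambda>\<omega>. (f (xi \<omega> x))^2)" for x
    by (rule integrable_ident[OF f2 sq])
  have v0: "?v \<ge> 0" by simp
  have Xm: "X p \<in> borel_measurable M" for p
    unfolding X_def[abs_def] using meas_comp[OF f] meas_comp[OF g] by measurable
  \<comment> \<open>The two \<open>f\<close> factors are split by the inequality of arithmetic and
    geometric means, the two \<open>g\<close> factors are bounded by \<open>c\<close>.\<close>
  have XX: "\<bar>X p \<omega> * X q \<omega>\<bar> \<le> c^2 * ((f (xi \<omega> (fst p)))^2 + (f (xi \<omega> (fst q)))^2) / 2" for p q \<omega>
  proof -
    let ?a = "f (xi \<omega> (fst p))" and ?b = "f (xi \<omega> (fst q))"
    have "\<bar>X p \<omega> * X q \<omega>\<bar> = (\<bar>?a\<bar> * \<bar>?b\<bar>) * (\<bar>g (xi \<omega> (snd p))\<bar> * \<bar>g (xi \<omega> (snd q))\<bar>)"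
      by (simp add: X_def abs_mult)
    also have "\<dots> \<le> ((?a^2 + ?b^2) / 2) * (c * c)"
    proof (intro mult_mono)
      have "0 \<le> (\<bar>?a\<bar> - \<bar>?b\<bar>)^2" by simp
      then show "\<bar>?a\<bar> * \<bar>?b\<bar> \<le> (?a^2 + ?b^2) / 2" by (simp add: power2_diff)
    qed (use bound c0 in auto)
    finally show ?thesis by (simp add: power2_eq_square mult_ac)
  qed
  have XXi: "integrable M (\<lambda>\<omega>. X p \<omega> * X q \<omega>)" for p q
  proof (rule Bochner_Integration.integrable_bound)
    show "integrable M (\<lambda>\<omega>. c^2 * ((f (xi \<omega> (fst p)))^2 + (f (xi \<omega> (fst q)))^2) / 2)"
      using sqi by auto
    show "(\<lambda>\<omega>. X p \<omega> * X q \<omega>) \<in> borel_measurable M" using Xm by auto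
  qed (use XX in auto)
  have XXe: "expectation (\<lambda>\<omega>. X p \<omega> * X q \<omega>) \<le> c^2 * ?v"
    and XXe': "expectation (\<lambda>\<omega>. X p \<omega> * X q \<omega>) \<ge> - (c^2 * ?v)" for p q
  proof -
    have "\<bar>expectation (\<lambda>\<omega>. X p \<omega> * X q \<omega>)\<bar> \<le> expectation (\<lambda>\<omega>. \<bar>X p \<omega> * X q \<omega>\<bar>)"
      by (rule integral_abs_bound)
    also have "\<dots> \<le> expectation (\<lambda>\<omega>. c^2 * ((f (xi \<omega> (fst p)))^2 + (f (xi \<omega> (fst q)))^2) / 2)"
      using XX sqi XXi by (intro integral_mono) auto
    also have "\<dots> = c^2 * ?v"
      using sqi expectation_ident[OF f2, of "fst p" x0] expectation_ident[OF f2, of "fst q" x0] by simp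
    finally show "expectation (\<lambda>\<omega>. X p \<omega> * X q \<omega>) \<le> c^2 * ?v"
      "expectation (\<lambda>\<omega>. X p \<omega> * X q \<omega>) \<ge> - (c^2 * ?v)" by (auto simp: abs_le_iff)
  qed
  have XX0: "expectation (\<lambda>\<omega>. X p \<omega> * X q \<omega>) = 0"
    if "p \<in> P" "q \<in> P" "q \<noteq> p" "q \<noteq> prod.swap p" for p q
  proof -
    obtain x y x' y' where p: "p = (x,y)" and q: "q = (x',y')" by (metis surj_pair)
    have ne: "x \<noteq> y" "x' \<noteq> y'" using off that p q by auto
    define J where "J = {x,y,x',y'}"
    \<comment> \<open>Regroups the four factors by site. The conditionals also cover coinciding
      sites, where several factors collect at one \<open>s\<close>.\<close>
    define F where "F s t = ((if s = x then f t else 1) * (if s = x' then f t else 1)) *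
       ((if s = y then g t else 1) * (if s = y' then g t else 1))" for s t
    have Fm: "F s \<in> borel_measurable borel" for s
      unfolding F_def[abs_def] using f g by measurable
    have Fi: "integrable M (\<lambda>\<omega>. F s (xi \<omega> s))" for s
    proof (rule Bochner_Integration.integrable_bound)
      show "integrable M (\<lambda>\<omega>. (1 + (f (xi \<omega> s))^2) * ((1 + c) * (1 + c)))"
        using sqi[of s] by auto
      show "(\<lambda>\<omega>. F s (xi \<omega> s)) \<in> borel_measurable M" by (rule meas_comp[OF Fm])
      have "\<bar>F s t\<bar> \<le> (1 + (f t)^2) * ((1 + c) * (1 + c))" for t
        unfolding F_def abs_mult
      proof (intro mult_mono)
        \<comment> \<open>\<open>1 + (f t)^2\<close> dominates \<open>1\<close>, the absolute value
          of \<open>f t\<close> and \<open>(f t)^2\<close>, hence the cases of none, one or both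
          \<open>f\<close> factors at \<open>s\<close>.\<close>
        have "0 \<le> (\<bar>f t\<bar> - 1)^2 " by simp
        then have "2 * \<bar>f t\<bar> \<le> 1 + (f t)^2" by (simp add: power2_diff)
        then have "\<bar>f t\<bar> \<le> 1 + (f t)^2" using abs_ge_zero[of "f t"] by linarith
        then show "\<bar>if s = x then f t else 1\<bar> * \<bar>if s = x' then f t else 1\<bar> \<le> 1 + (f t)^2"
          by (simp add: power2_eq_square abs_mult_self_eq)
        show "\<bar>if s = y then g t else 1\<bar> \<le> 1 + c" "\<bar>if s = y' then g t else 1\<bar> \<le> 1 + c"
          using bound[of t] c0 by auto
      qed (use c0 in auto)
      then show "AE \<omega> in M. norm (F s (xi \<omega> s)) \<le> norm ((1 + (f (xi \<omega> s))^2) * ((1 + c) * (1 + c)))"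
        using c0 by (auto simp: abs_mult)
    qed
    have "X p \<omega> * X q \<omega> = (\<Prod>s\<in>J. F s (xi \<omega> s))" for \<omega>
      unfolding F_def prod.distrib using p q by (simp add: J_def X_def prod.delta mult_ac)
    then have "expectation (\<lambda>\<omega>. X p \<omega> * X q \<omega>) = (\<Prod>s\<in>J. expectation (\<lambda>\<omega>. F s (xi \<omega> s)))"
      using expectation_prod[of J F] Fm Fi by (simp add: J_def)
    moreover have "\<exists>s\<in>J. expectation (\<lambda>\<omega>. F s (xi \<omega> s)) = 0"
    \<comment> \<open>If \<open>x\<close> meets neither site of \<open>q\<close>, it carries a lone
      \<open>f\<close>. Otherwise \<open>y\<close> carries a lone \<open>g\<close>:
      \<open>x = x'\<close> excludes \<open>y = y'\<close> as \<open>q \<noteq> p\<close>, and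
      \<open>x = y'\<close> excludes \<open>y = x'\<close> as \<open>q\<close> is not the swap of
      \<open>p\<close>.\<close>
    proof (cases "x = x' \<or> x = y'")
      case False
      then have "F x = f" using ne by (auto simp: F_def)
      then show ?thesis using mean_f expectation_ident[OF f, of x x0] by (auto simp: J_def)
    next
      case True
      then have "y \<noteq> x'" "y \<noteq> y'" using that(3,4) ne p q by auto
      then have "F y = g" using ne by (auto simp: F_def)
      then show ?thesis using mean_g expectation_ident[OF g, of y x0] by (auto simp: J_def)
    qed
    ultimately show ?thesis by (simp add: J_def)
  qed
  have eq: "(\<Sum>(x,y)\<in>P. k x y * (f (xi \<omega> x) * g (xi \<omega> y)))^2
     = (\<Sum>p\<in>P. \<Sum>q\<in>P. kk p * kk q * (X p \<omega> * X q \<omega>))" for \<omega>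
    by (simp add: power2_eq_square sum_product kk_def X_def case_prod_unfold mult_ac)
  show "integrable M (\<lambda>\<omega>. (\<Sum>(x,y)\<in>P. k x y * (f (xi \<omega> x) * g (xi \<omega> y)))^2)"
    unfolding eq using XXi by (intro Bochner_Integration.integrable_sum integrable_mult_right) auto
  have "expectation (\<lambda>\<omega>. (\<Sum>(x,y)\<in>P. k x y * (f (xi \<omega> x) * g (xi \<omega> y)))^2)
     = (\<Sum>p\<in>P. \<Sum>q\<in>P. kk p * kk q * expectation (\<lambda>\<omega>. X p \<omega> * X q \<omega>))"
    unfolding eq using XXi
    by (subst Bochner_Integration.integral_sum, intro Bochner_Integration.integrable_sum integrable_mult_right, simp)
       (intro sum.cong refl, subst Bochner_Integration.integral_sum, auto intro: integrable_mult_right)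
  also have "\<dots> \<le> (\<Sum>p\<in>P. 2 * c^2 * ?v * (kk p)^2)"
  proof (rule sum_mono)
    fix p assume p: "p \<in> P"
    have "kk p * kk q * expectation (\<lambda>\<omega>. X p \<omega> * X q \<omega>)
        \<le> (if q \<in> {p, prod.swap p} then (kk p)^2 * (c^2 * ?v) else 0)" if q: "q \<in> P" for q
    proof (cases "q \<in> {p, prod.swap p}")
      case True
      \<comment> \<open>Symmetry of \<open>k\<close> turns the weight into a square, so the upper
        bound on the expectation may be multiplied by it.\<close>
      then have "kk q = kk p" using sym by (auto simp: kk_def)
      then show ?thesis using True mult_left_mono[OF XXe, of "kk p * kk p" p q]
        by (auto simp: power2_eq_square)
    qed (use XX0[OF p q] in simp)
    then have "(\<Sum>q\<in>P. kk p * kk q * expectation (\<lambda>\<omega>. X p \<omega> * X q \<omega>))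
       \<le> (\<Sum>q\<in>P. if q \<in> {p, prod.swap p} then (kk p)^2 * (c^2 * ?v) else 0)"
      by (rule sum_mono)
    also have "\<dots> = real (card (P \<inter> {p, prod.swap p})) * ((kk p)^2 * (c^2 * ?v))"
      unfolding sum.If_cases[OF fin] Collect_mem_eq by simp
    also have "\<dots> \<le> 2 * ((kk p)^2 * (c^2 * ?v))"
    proof (rule mult_right_mono)
      have "card (P \<inter> {p, prod.swap p}) \<le> card {p, prod.swap p}" by (intro card_mono) auto
      also have "\<dots> \<le> 2" by (simp add: card_insert_if)
      finally show "real (card (P \<inter> {p, prod.swap p})) \<le> 2" by simp
    qed simp
    finally show "(\<Sum>q\<in>P. kk p * kk q * expectation (\<lambda>\<omega>. X p \<omega> * X q \<omega>)) \<le> 2 * c^2 * ?v * (kk p)^2"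
      by (simp add: mult_ac)
  qed
  also have "\<dots> = 2 * c^2 * ?v * (\<Sum>(x,y)\<in>P. (k x y)^2)"
    by (simp add: sum_distrib_left kk_def case_prod_unfold)
  finally show "expectation (\<lambda>\<omega>. (\<Sum>(x,y)\<in>P. k x y * (f (xi \<omega> x) * g (xi \<omega> y)))^2)
        \<le> 2 * c^2 * ?v * (\<Sum>(x,y)\<in>P. (k x y)^2)" .
qed

end

section \<open>Random interfaces\<close>

lemma divide_le_third:
  fixes a s v \<delta> :: real
  assumes "s > 0" "v > 0" "\<delta> > 0" "3 * a / (s * \<delta>) \<le> v"
  shows "(a / s) / v \<le> \<delta> / 3"
proof -
  have "3 * a \<le> v * (s * \<delta>)" using assms by (simp add: pos_divide_le_eq)
  then have "a \<le> (\<delta> / 3) * (s * v)" by (simp add: mult_ac)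
  then show ?thesis using assms by (simp add: pos_divide_le_eq mult_ac)
qed

lemma abs_le_of_sq_less:
  fixes x y :: real
  assumes "x^2 < y^2" "y > 0"
  shows "\<bar>x\<bar> \<le> y"
  using assms abs_le_square_iff[of x y] by simp

text \<open>The potential enters through measurability and two parabolic bounds. The tilt
  \<open>u\<close> is fixed because the exceptional null set may depend on it.\<close>

locale disordered_interface = iid_family M xi
  for M :: "'w measure" and xi :: "'w \<Rightarrow> int^'d \<Rightarrow> real" +
  fixes V :: "real \<Rightarrow> real" and A B b C :: real and u :: "real^'d"
  assumes V_meas: "V \<in> borel_measurable borel"
    and A_pos: "A > 0" and V_lower: "\<And>s. V s \<ge> A * s^2 - B"
    and V_upper: "\<And>s. V s \<le> b + C * s^2" and b_nonneg: "b \<ge> 0" and C_pos: "C > 0"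
    and sq_int: "integrable M (\<lambda>\<omega>. (xi \<omega> 0)^2)"
begin

definition vol :: "nat \<Rightarrow> real" where
  "vol N = real (card (box N :: (int^'d) set))"

definition deg :: real where
  "deg = real (card (unit_steps :: (int^'d) set))"

definition slope :: real where
  "slope = (\<Sum>i\<in>UNIV. \<bar>u$i\<bar>)"

definition base_cost :: real where
  "base_cost = deg * (b + 3 * C * (slope^2 + 1))"

abbreviation mean :: real where
  "mean \<equiv> expectation (\<lambda>\<omega>. xi \<omega> 0)"

abbreviation var :: real where
  "var \<equiv> expectation (\<lambda>\<omega>. (xi \<omega> 0 - mean)^2)"

lemma vol_pos: "vol N > 0"
  using card_box_pos[of N, where 'd='d] by (simp add: vol_def)

lemma vol_ge: "vol N \<ge> 2 * real N + 1"
proof -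
  have "(2 * real N + 1) ^ 1 \<le> (2 * real N + 1) ^ CARD('d)"
    by (intro power_increasing) (auto simp: Suc_le_eq)
  then show ?thesis by (simp add: vol_def card_box add.commute)
qed

lemma deg_nonneg: "deg \<ge> 0"
  by (simp add: deg_def)

lemma var_nonneg: "var \<ge> 0"
  by simp

lemma integrable_xi: "integrable M (\<lambda>\<omega>. xi \<omega> x)"
proof -
  have "integrable M (\<lambda>\<omega>. xi \<omega> 0)"
    by (rule square_integrable_imp_integrable[OF meas sq_int])
  then show ?thesis using integrable_ident[of "\<lambda>t. t" 0 x] by simp
qed

lemma interface_bound:
  assumes "\<And>x. x \<notin> box N \<Longrightarrow> h x = 0"
  shows "surface_tension V N (xi \<omega>) u \<le> base_cost + (3 * C * energy N h + (\<Sum>x\<in>box N. xi \<omega> x * tilt u x) / 2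
     + (\<Sum>x\<in>box N. xi \<omega> x * h x) / 2 + (\<Sum>x\<in>box N. \<bar>xi \<omega> x\<bar>) / 4) / vol N"
  using surface_tension_le[OF V_meas A_pos V_lower V_upper b_nonneg, of N h "xi \<omega>" u] C_pos assms
  unfolding base_cost_def deg_def slope_def vol_def by simp

section \<open>Tail bounds for sums of the disorder\<close>

lemma prob_abs_sum_ge:
  assumes "L > 0"
  shows "prob {\<omega>\<in>space M. (\<Sum>x\<in>box N. \<bar>xi \<omega> x\<bar>) \<ge> L * vol N} \<le> expectation (\<lambda>\<omega>. \<bar>xi \<omega> 0\<bar>) / L"
proof -
  have e: "expectation (\<lambda>\<omega>. \<bar>xi \<omega> x\<bar>) = expectation (\<lambda>\<omega>. \<bar>xi \<omega> 0\<bar>)" for x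
    using expectation_ident[of abs x 0] by simp
  have "prob {\<omega>\<in>space M. (\<Sum>x\<in>box N. \<bar>xi \<omega> x\<bar>) \<ge> L * vol N}
     \<le> (vol N * expectation (\<lambda>\<omega>. \<bar>xi \<omega> 0\<bar>)) / (L * vol N)"
  proof (rule markov_le)
    have "expectation (\<lambda>\<omega>. \<Sum>x\<in>box N. \<bar>xi \<omega> x\<bar>) = (\<Sum>x\<in>(box N :: (int^'d) set). expectation (\<lambda>\<omega>. \<bar>xi \<omega> x\<bar>))"
      using integrable_xi by (intro Bochner_Integration.integral_sum integrable_abs)
    also have "\<dots> = (\<Sum>x\<in>(box N :: (int^'d) set). expectation (\<lambda>\<omega>. \<bar>xi \<omega> 0\<bar>))"
      by (rule sum.cong[OF refl e])
    finally show "expectation (\<lambda>\<omega>. \<Sum>x\<in>box N. \<bar>xi \<omega> x\<bar>) \<le> vol N * expectation (\<lambda>\<omega>. \<bar>xi \<omega> 0\<bar>)"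
      by (simp add: vol_def)
  qed (use assms vol_pos integrable_xi in \<open>auto intro!: sum_nonneg\<close>)
  then show ?thesis using vol_pos[of N] by simp
qed

text \<open>Chebyshev's inequality, phrased with squares so that \<open>markov_le\<close> applies
  directly; the weights enter through a bound on their sum of squares.\<close>

lemma prob_centered_sum_ge:
  assumes "T > 0" and w: "(\<Sum>x\<in>S. (w x)^2) \<le> L" and "finite S"
  shows "prob {\<omega>\<in>space M. (\<Sum>x\<in>S. w x * (xi \<omega> x - mean))^2 \<ge> T^2} \<le> var * L / T^2"
proof (rule markov_le)
  have m: "expectation (\<lambda>\<omega>. xi \<omega> 0 - mean) = 0" using integrable_xi by (simp add: prob_space)
  have s: "integrable M (\<lambda>\<omega>. (xi \<omega> 0 - mean)^2)"
    using sq_int integrable_xi by (simp add: power2_diff)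
  show "integrable M (\<lambda>\<omega>. (\<Sum>x\<in>S. w x * (xi \<omega> x - mean))^2)"
    using integrable_weighted_sum_sq[of "\<lambda>t. t - mean" 0 S w] m s assms by simp
  have "expectation (\<lambda>\<omega>. (\<Sum>x\<in>S. w x * (xi \<omega> x - mean))^2) = var * (\<Sum>x\<in>S. (w x)^2)"
    using expectation_weighted_sum_sq[of "\<lambda>t. t - mean" 0 S w] m s assms by simp
  also have "\<dots> \<le> var * L" by (intro mult_left_mono w var_nonneg)
  finally show "expectation (\<lambda>\<omega>. (\<Sum>x\<in>S. w x * (xi \<omega> x - mean))^2) \<le> var * L" .
qed (use assms in auto)

lemma sum_tilt_sq_le: "(\<Sum>x\<in>box N. (tilt u x)^2) \<le> (real N * slope)^2 * vol N"
proof -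
  have "(\<Sum>x\<in>box N. (tilt u x)^2) \<le> (\<Sum>x\<in>(box N :: (int^'d) set). (real N * slope)^2)"
  proof (rule sum_mono)
    fix x :: "int^'d" assume "x \<in> box N"
    then have "\<bar>tilt u x\<bar> \<le> real N * slope" using abs_tilt_le unfolding slope_def by blast
    then have "\<bar>tilt u x\<bar>^2 \<le> (real N * slope)^2" by (intro power_mono) auto
    then show "(tilt u x)^2 \<le> (real N * slope)^2" by simp
  qed
  then show ?thesis by (simp add: vol_def mult.commute)
qed

section \<open>Nonzero mean\<close>

text \<open>Distance to the first layer outside the box: \<open>Suc N\<close> gives the outermost
  layer of the box height one, and truncated subtraction gives zero outside.\<close>

definition dist_bdry :: "nat \<Rightarrow> int^'d \<Rightarrow> real" where
  "dist_bdry N x = real (Suc N - sup_norm x)"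

lemma dist_bdry_eq_0: "x \<notin> box N \<Longrightarrow> dist_bdry N x = 0"
  using sup_norm_le_iff[of x N] by (simp add: dist_bdry_def)

text \<open>The max norm changes by at most one along a unit step, so every increment is at most the
  absolute value of \<open>s\<close>.\<close>

lemma energy_dist_bdry_le: "energy N (\<lambda>x. s * dist_bdry N x) \<le> s^2 * (vol N * deg)"
proof -
  have "energy N (\<lambda>x. s * dist_bdry N x) \<le> (\<Sum>x\<in>(box N :: (int^'d) set). \<Sum>z\<in>(unit_steps :: (int^'d) set). s^2)"
    unfolding energy_def
  proof (intro sum_mono)
    fix x z :: "int^'d" assume z: "z \<in> unit_steps"
    have "\<bar>dist_bdry N x - dist_bdry N (x + z)\<bar> \<le> 1"
      using sup_norm_step_le[OF z, of x] sup_norm_step_ge[OF z, of x]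
      unfolding dist_bdry_def by linarith
    then have "(dist_bdry N x - dist_bdry N (x + z))^2 \<le> 1" by (simp add: abs_square_le_1)
    then have "s^2 * (dist_bdry N x - dist_bdry N (x + z))^2 \<le> s^2 * 1" by (intro mult_left_mono) auto
    then show "(s * dist_bdry N x - s * dist_bdry N (x + z))^2 \<le> s^2"
      by (simp add: power_mult_distrib right_diff_distrib[symmetric])
  qed
  then show ?thesis by (simp add: vol_def deg_def mult_ac)
qed

text \<open>Restrict to the concentric box of half the radius. Heights there are at least
  \<open>N / 2\<close>, and it holds at least a fraction \<open>1 / 3^d\<close> of the volume,
  because \<open>2 * N + 1 \<le> 3 * (2 * (N div 2) + 1)\<close>.\<close>

lemma sum_dist_bdry_ge: "(\<Sum>x\<in>box N. dist_bdry N x) \<ge> real N * vol N / (2 * 3 ^ CARD('d))"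
proof -
  let ?k = "N div 2"
  have "(3 * (2 * ?k + 1)) ^ CARD('d) \<ge> (2 * N + 1) ^ CARD('d)" if "N \<ge> 1"
    using that by (intro power_mono) auto
  then have "N * (3 ^ CARD('d) * (2 * ?k + 1) ^ CARD('d)) \<ge> N * (2 * N + 1) ^ CARD('d)"
    unfolding power_mult_distrib by (cases "N = 0") auto
  then have "real (N * (3 ^ CARD('d) * (2 * ?k + 1) ^ CARD('d))) \<ge> real (N * (2 * N + 1) ^ CARD('d))"
    by (simp only: of_nat_le_iff)
  then have v: "real N * (3 ^ CARD('d) * vol ?k) \<ge> real N * vol N"
    by (simp add: vol_def card_box)
  have "real N / 2 * vol ?k = (\<Sum>x\<in>(box ?k :: (int^'d) set). real N / 2)"
    by (simp add: vol_def)
  also have "\<dots> \<le> (\<Sum>x\<in>box ?k. dist_bdry N x)"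
  proof (rule sum_mono)
    fix x :: "int^'d" assume "x \<in> box ?k"
    then have "sup_norm x \<le> ?k" by (simp add: sup_norm_le_iff)
    then show "real N / 2 \<le> dist_bdry N x" unfolding dist_bdry_def by linarith
  qed
  also have "\<dots> \<le> (\<Sum>x\<in>box N. dist_bdry N x)"
  proof (rule sum_mono2)
    show "(box ?k :: (int^'d) set) \<subseteq> box N" by (intro box_mono) simp
  qed (auto simp: dist_bdry_def)
  finally have "real N / 2 * vol ?k \<le> (\<Sum>x\<in>box N. dist_bdry N x)" .
  moreover have "real N * vol N / (2 * 3 ^ CARD('d)) \<le> real N / 2 * vol ?k"
    using v by (simp add: field_simps)
  ultimately show ?thesis by linarith
qed

lemma sum_dist_bdry_sq_le: "(\<Sum>x\<in>box N. (dist_bdry N x)^2) \<le> (real N + 1)^2 * vol N"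
proof -
  have "(\<Sum>x\<in>box N. (dist_bdry N x)^2) \<le> (\<Sum>x\<in>(box N :: (int^'d) set). (real N + 1)^2)"
    by (intro sum_mono power_mono) (auto simp: dist_bdry_def)
  then show ?thesis by (simp add: vol_def mult.commute)
qed

text \<open>On the good event the mean gives the interface a gain of at least \<open>4 * T\<close>,
  its fluctuation takes back at most \<open>T\<close>, and the tilt sum is at most \<open>T\<close>.
  After halving, this contributes at most \<open>- T\<close>, that is \<open>- t * N\<close> per
  site, while energy and cube terms stay bounded per site.\<close>

lemma surface_tension_unbounded_mean_nonzero:
  assumes mean: "mean \<noteq> 0" and \<delta>: "\<delta> > 0"
  shows "\<exists>N. \<exists>Bd\<in>events. prob Bd \<le> \<delta> \<and> (\<forall>\<omega>\<in>space M - Bd. surface_tension V N (xi \<omega>) u \<le> - K)"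
proof -
  \<comment> \<open>Makes Markov's inequality give at most \<open>\<delta> / 3\<close> for
    \<open>B1\<close>; the \<open>+ 1\<close> keeps \<open>L\<close> positive.\<close>
  define L where "L = 3 * (expectation (\<lambda>\<omega>. \<bar>xi \<omega> 0\<bar>) + 1) / \<delta>"
  define \<kappa> where "\<kappa> = 1 / (2 * 3 ^ CARD('d) :: real)"
  \<comment> \<open>A quarter of the drift constant, so that the drift is at least
    \<open>4 * T\<close> with \<open>T = t * N * vol N\<close>.\<close>
  define t where "t = \<bar>mean\<bar> * \<kappa> / 4"
  \<comment> \<open>The nested maxima serve, in this order, \<open>N \<ge> 1\<close>, the bounds
    \<open>p2\<close> and \<open>p3\<close>, and the final estimate.\<close>
  define N where "N = nat \<lceil>max 1 (max (3 * var * slope^2 / (t^2 * \<delta>)) (max (12 * var / (t^2 * \<delta>))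
      ((base_cost + 3 * C * deg + L / 4 + K) / t)))\<rceil>"
  have Eabs: "expectation (\<lambda>\<omega>. \<bar>xi \<omega> 0\<bar>) \<ge> 0" by simp
  have L: "L > 0" using \<delta> Eabs by (simp add: L_def add_nonneg_pos)
  have \<kappa>: "\<kappa> > 0" by (simp add: \<kappa>_def)
  have t: "t > 0" using mean \<kappa> by (simp add: t_def)
  have N: "real N \<ge> 1" "real N \<ge> 3 * var * slope^2 / (t^2 * \<delta>)" "real N \<ge> 12 * var / (t^2 * \<delta>)"
     "real N \<ge> (base_cost + 3 * C * deg + L / 4 + K) / t"
    unfolding N_def by linarith+
  have vN: "vol N \<ge> real N" using vol_ge[of N] by linarith
  define T where "T = t * real N * vol N"
  have T: "T > 0" using t N(1) vol_pos by (simp add: T_def)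
  define s where "s = - sgn mean"
  define h where "h x = s * dist_bdry N x" for x
  define B1 where "B1 = {\<omega>\<in>space M. (\<Sum>x\<in>box N. \<bar>xi \<omega> x\<bar>) \<ge> L * vol N}"
  define B2 where "B2 = {\<omega>\<in>space M. (\<Sum>x\<in>box N. tilt u x * (xi \<omega> x - mean))^2 \<ge> T^2}"
  define B3 where "B3 = {\<omega>\<in>space M. (\<Sum>x\<in>box N. dist_bdry N x * (xi \<omega> x - mean))^2 \<ge> T^2}"
  have ev: "B1 \<in> events" "B2 \<in> events" "B3 \<in> events"
    unfolding B1_def B2_def B3_def by measurable
  have p1: "prob B1 \<le> \<delta> / 3"
  proof -
    have "prob B1 \<le> expectation (\<lambda>\<omega>. \<bar>xi \<omega> 0\<bar>) / L" unfolding B1_def by (rule prob_abs_sum_ge[OF L])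
    also have "\<dots> \<le> \<delta> / 3"
    proof -
      have "\<delta> / 3 * L = expectation (\<lambda>\<omega>. \<bar>xi \<omega> 0\<bar>) + 1" using \<delta> by (simp add: L_def)
      then show ?thesis by (simp add: pos_divide_le_eq[OF L])
    qed
    finally show ?thesis .
  qed
  have p2: "prob B2 \<le> \<delta> / 3"
  proof -
    have "prob B2 \<le> var * ((real N * slope)^2 * vol N) / T^2"
      unfolding B2_def by (rule prob_centered_sum_ge[OF T sum_tilt_sq_le]) simp
    also have "\<dots> = (var * slope^2 / t^2) / vol N"
      using vol_pos[of N] N(1) t by (simp add: T_def power_mult_distrib power2_eq_square field_simps)
    also have "\<dots> \<le> \<delta> / 3"
      by (rule divide_le_third) (use N(2) vN vol_pos t \<delta> in \<open>auto simp: mult_ac\<close>)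
    finally show ?thesis .
  qed
  have p3: "prob B3 \<le> \<delta> / 3"
  proof -
    have "prob B3 \<le> var * ((real N + 1)^2 * vol N) / T^2"
      unfolding B3_def by (rule prob_centered_sum_ge[OF T sum_dist_bdry_sq_le]) simp
    \<comment> \<open>\<open>N \<ge> 1\<close> allows \<open>2 * N\<close> in place of
      \<open>N + 1\<close>; this is the origin of \<open>12 = 3 * 4\<close> in the choice of
      \<open>N\<close>.\<close>
    also have "\<dots> \<le> var * ((2 * real N)^2 * vol N) / T^2"
      using N(1) vol_pos[of N] T
      by (intro divide_right_mono mult_left_mono mult_right_mono power_mono) auto
    also have "\<dots> = (4 * var / t^2) / vol N"
      using vol_pos[of N] N(1) t by (simp add: T_def power_mult_distrib power2_eq_square field_simps)
    also have "\<dots> \<le> \<delta> / 3"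
      by (rule divide_le_third) (use N(3) vN vol_pos t \<delta> in \<open>auto simp: mult_ac\<close>)
    finally show ?thesis .
  qed
  have "prob (B1 \<union> B2 \<union> B3) \<le> \<delta>"
    using measure_Un_le[of "B1 \<union> B2" M B3] measure_Un_le[of B1 M B2] ev p1 p2 p3 by simp
  moreover have "surface_tension V N (xi \<omega>) u \<le> - K" if "\<omega> \<in> space M - (B1 \<union> B2 \<union> B3)" for \<omega>
  proof -
    have b1: "(\<Sum>x\<in>box N. \<bar>xi \<omega> x\<bar>) \<le> L * vol N"
      using that unfolding B1_def by auto
    have "(\<Sum>x\<in>box N. tilt u x * (xi \<omega> x - mean))^2 < T^2"
      "(\<Sum>x\<in>box N. dist_bdry N x * (xi \<omega> x - mean))^2 < T^2"
      using that unfolding B2_def B3_def by auto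
    then have b2': "\<bar>\<Sum>x\<in>box N. tilt u x * (xi \<omega> x - mean)\<bar> \<le> T"
      and b3: "\<bar>\<Sum>x\<in>box N. dist_bdry N x * (xi \<omega> x - mean)\<bar> \<le> T"
      using T by (auto intro!: abs_le_of_sq_less)
    from b2' have b2: "(\<Sum>x\<in>box N. tilt u x * (xi \<omega> x - mean)) \<le> T" by linarith
    \<comment> \<open>Split the disorder into its centred part and its mean;
      \<open>sum_tilt_box\<close> then removes the mean part.\<close>
    have "(\<Sum>x\<in>box N. xi \<omega> x * tilt u x) = (\<Sum>x\<in>box N. tilt u x * (xi \<omega> x - mean)) + mean * (\<Sum>x\<in>box N. tilt u x)"
      unfolding sum_distrib_left sum.distrib[symmetric] by (intro sum.cong) (auto simp: algebra_simps)
    then have 2: "(\<Sum>x\<in>box N. xi \<omega> x * tilt u x) \<le> T" using b2 by (simp add: sum_tilt_box)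
    have "(\<Sum>x\<in>box N. xi \<omega> x * h x) = s * (\<Sum>x\<in>box N. dist_bdry N x * (xi \<omega> x - mean)) + s * mean * (\<Sum>x\<in>box N. dist_bdry N x)"
      unfolding sum_distrib_left sum.distrib[symmetric] h_def by (intro sum.cong) (auto simp: algebra_simps)
    moreover have "s * mean = - \<bar>mean\<bar>" by (simp add: s_def abs_sgn mult.commute)
    moreover have "s * (\<Sum>x\<in>box N. dist_bdry N x * (xi \<omega> x - mean)) \<le> T"
    proof -
      have "\<bar>s\<bar> = 1" using mean by (simp add: s_def abs_sgn_eq)
      then have "\<bar>s * y\<bar> = \<bar>y\<bar>" for y by (simp add: abs_mult)
      then have "s * y \<le> \<bar>y\<bar>" for y using abs_ge_self[of "s * y"] by simp
      then show ?thesis using b3 by (rule order_trans)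
    qed
    moreover have "\<bar>mean\<bar> * (\<Sum>x\<in>box N. dist_bdry N x) \<ge> 4 * T"
    proof -
      have "real N * vol N * \<kappa> \<le> (\<Sum>x\<in>box N. dist_bdry N x)"
        using sum_dist_bdry_ge[of N] by (simp add: \<kappa>_def)
      then have "\<bar>mean\<bar> * (real N * vol N * \<kappa>) \<le> \<bar>mean\<bar> * (\<Sum>x\<in>box N. dist_bdry N x)"
        by (intro mult_left_mono) auto
      then show ?thesis by (simp add: T_def t_def mult_ac)
    qed
    ultimately have 3: "(\<Sum>x\<in>box N. xi \<omega> x * h x) \<le> - 3 * T" by simp
    have "s^2 = 1" using mean by (simp add: s_def sgn_if)
    then have "energy N h \<le> vol N * deg" using energy_dist_bdry_le[of N s] unfolding h_def[abs_def] by simp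
    then have 4: "3 * C * energy N h \<le> 3 * C * (vol N * deg)" using C_pos by simp
    have "surface_tension V N (xi \<omega>) u \<le> base_cost + (3 * C * energy N h + (\<Sum>x\<in>box N. xi \<omega> x * tilt u x) / 2
     + (\<Sum>x\<in>box N. xi \<omega> x * h x) / 2 + (\<Sum>x\<in>box N. \<bar>xi \<omega> x\<bar>) / 4) / vol N"
      by (rule interface_bound) (simp add: h_def dist_bdry_eq_0)
    also have "\<dots> \<le> base_cost + (3 * C * (vol N * deg) + T / 2 + (- 3 * T) / 2 + (L * vol N) / 4) / vol N"
    proof (rule add_left_mono, rule divide_right_mono)
      show "3 * C * energy N h + (\<Sum>x\<in>box N. xi \<omega> x * tilt u x) / 2
          + (\<Sum>x\<in>box N. xi \<omega> x * h x) / 2 + (\<Sum>x\<in>box N. \<bar>xi \<omega> x\<bar>) / 4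
        \<le> 3 * C * (vol N * deg) + T / 2 + (- 3 * T) / 2 + (L * vol N) / 4"
        using 2 3 4 b1 by linarith
    qed (use vol_pos[of N] in simp)
    also have "\<dots> = base_cost + 3 * C * deg + L / 4 - t * real N"
      using vol_pos[of N] by (simp add: T_def field_simps)
    also have "\<dots> \<le> - K"
    proof -
      have "base_cost + 3 * C * deg + L / 4 + K \<le> real N * t" using N(4) t by (simp add: field_simps)
      then show ?thesis by (simp add: mult.commute)
    qed
    finally show ?thesis .
  qed
  ultimately show ?thesis using ev by (intro exI[of _ N] bexI[of _ "B1 \<union> B2 \<union> B3"]) auto
qed

section \<open>Zero mean in dimensions one and two\<close>

abbreviation sq_mean :: real where
  "sq_mean \<equiv> expectation (\<lambda>\<omega>. (xi \<omega> 0)^2)"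

text \<open>A bounded truncation that keeps the sign, so that \<open>t * clip t\<close> is
  nonnegative and vanishes only at zero.\<close>

definition clip :: "real \<Rightarrow> real" where
  "clip t = max (- 1) (min 1 t)"

definition eta :: "real \<Rightarrow> real" where
  "eta t = clip t - expectation (\<lambda>\<omega>. clip (xi \<omega> 0))"

text \<open>The mean gain per site, before multiplication by \<open>green R 0\<close>.\<close>

definition corr :: real where
  "corr = expectation (\<lambda>\<omega>. xi \<omega> 0 * eta (xi \<omega> 0))"

lemma borel_measurable_clip [measurable]: "clip \<in> borel_measurable borel"
  unfolding clip_def[abs_def] by measurable

lemma borel_measurable_eta [measurable]: "eta \<in> borel_measurable borel"
  unfolding eta_def[abs_def] by measurable

lemma abs_clip_le: "\<bar>clip t\<bar> \<le> 1"
  by (simp add: clip_def)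

lemma integrable_clip: "integrable M (\<lambda>\<omega>. clip (xi \<omega> x))"
  by (rule integrable_const_bound[where B = 1]) (auto simp: abs_clip_le)

lemma abs_eta_le: "\<bar>eta t\<bar> \<le> 2"
proof -
  have "\<bar>expectation (\<lambda>\<omega>. clip (xi \<omega> 0))\<bar> \<le> expectation (\<lambda>\<omega>. \<bar>clip (xi \<omega> 0)\<bar>)"
    by (rule integral_abs_bound)
  also have "\<dots> \<le> expectation (\<lambda>\<omega>. 1)"
    using integrable_clip by (intro integral_mono) (auto simp: abs_clip_le)
  finally have "\<bar>expectation (\<lambda>\<omega>. clip (xi \<omega> 0))\<bar> \<le> 1" by (simp add: prob_space)
  then show ?thesis using abs_clip_le[of t] unfolding eta_def by linarith
qed

lemma eta_sq_le: "(eta t)^2 \<le> 4"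
proof -
  have "\<bar>eta t\<bar>^2 \<le> 2^2" by (intro power_mono abs_eta_le) simp
  then show ?thesis by simp
qed

lemma expectation_eta: "expectation (\<lambda>\<omega>. eta (xi \<omega> 0)) = 0"
  unfolding eta_def using integrable_clip by (simp add: prob_space)

lemma integrable_eta_sq: "integrable M (\<lambda>\<omega>. (eta (xi \<omega> x))^2)"
  by (rule integrable_const_bound[where B = 4]) (auto simp: eta_sq_le)

lemma expectation_eta_sq_le: "expectation (\<lambda>\<omega>. (eta (xi \<omega> 0))^2) \<le> 4"
proof -
  have "expectation (\<lambda>\<omega>. (eta (xi \<omega> 0))^2) \<le> expectation (\<lambda>\<omega>. 4)"
    using integrable_eta_sq by (intro integral_mono) (auto simp: eta_sq_le)
  then show ?thesis by (simp add: prob_space)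
qed

lemma xi_eta_sq_le: "(t * eta t)^2 \<le> 4 * t^2"
  using mult_left_mono[OF eta_sq_le[of t], of "t^2"] by (simp add: power_mult_distrib mult.commute)

lemma integrable_xi_eta_sq: "integrable M (\<lambda>\<omega>. (xi \<omega> 0 * eta (xi \<omega> 0))^2)"
proof (rule Bochner_Integration.integrable_bound)
  show "integrable M (\<lambda>\<omega>. 4 * (xi \<omega> 0)^2)" using sq_int by simp
  show "(\<lambda>\<omega>. (xi \<omega> 0 * eta (xi \<omega> 0))^2) \<in> borel_measurable M" by measurable
  show "AE \<omega> in M. norm ((xi \<omega> 0 * eta (xi \<omega> 0))^2) \<le> norm (4 * (xi \<omega> 0)^2)"
    using xi_eta_sq_le by simp
qed

lemma integrable_xi_eta: "integrable M (\<lambda>\<omega>. xi \<omega> 0 * eta (xi \<omega> 0))"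
  by (rule square_integrable_imp_integrable[OF _ integrable_xi_eta_sq]) measurable

lemma expectation_xi_eta_sq_le: "expectation (\<lambda>\<omega>. (xi \<omega> 0 * eta (xi \<omega> 0))^2) \<le> 4 * sq_mean"
proof -
  have "expectation (\<lambda>\<omega>. (xi \<omega> 0 * eta (xi \<omega> 0))^2) \<le> expectation (\<lambda>\<omega>. 4 * (xi \<omega> 0)^2)"
    using integrable_xi_eta_sq sq_int by (intro integral_mono) (auto simp: xi_eta_sq_le)
  then show ?thesis by simp
qed

text \<open>As the mean is zero, the centring constant of \<open>eta\<close> drops out and
  \<open>corr\<close> becomes the expectation of a nonnegative variable that vanishes only where
  \<open>xi \<omega> 0\<close> does.\<close>

lemma corr_pos:
  assumes mean: "mean = 0" and sq: "sq_mean \<noteq> 0"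
  shows "corr > 0"
proof -
  let ?e = "expectation (\<lambda>\<omega>. clip (xi \<omega> 0))"
  have nn: "t * clip t \<ge> 0" for t
    by (cases "t \<ge> 0") (auto simp: clip_def min_def max_def mult_nonpos_nonpos)
  have z: "t * clip t = 0 \<longleftrightarrow> t = 0" for t by (auto simp: clip_def min_def max_def)
  have i: "integrable M (\<lambda>\<omega>. xi \<omega> 0 * clip (xi \<omega> 0))"
  proof -
    have "xi \<omega> 0 * clip (xi \<omega> 0) = xi \<omega> 0 * eta (xi \<omega> 0) + ?e * xi \<omega> 0" for \<omega>
      by (simp add: eta_def algebra_simps)
    then show ?thesis using integrable_xi_eta integrable_xi[of 0] by simp
  qed
  have "corr = expectation (\<lambda>\<omega>. xi \<omega> 0 * clip (xi \<omega> 0) - ?e * xi \<omega> 0)"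
    unfolding corr_def eta_def by (intro arg_cong[where f = expectation] ext) (simp add: algebra_simps)
  also have "\<dots> = expectation (\<lambda>\<omega>. xi \<omega> 0 * clip (xi \<omega> 0))"
    using i integrable_xi[of 0] mean by simp
  finally have c: "corr = expectation (\<lambda>\<omega>. xi \<omega> 0 * clip (xi \<omega> 0))" .
  have "corr \<noteq> 0"
  proof
    assume "corr = 0"
    then have "AE \<omega> in M. xi \<omega> 0 * clip (xi \<omega> 0) = 0"
      using integral_nonneg_eq_0_iff_AE[OF i] nn c by simp
    then have "AE \<omega> in M. (xi \<omega> 0)^2 = 0" by eventually_elim (simp only: z, simp)
    then have "sq_mean = 0" by (rule integral_eq_zero_AE)
    then show False using sq by simp
  qed
  moreover have "corr \<ge> 0" unfolding c using nn by simp
  ultimately show ?thesis by simp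
qed

text \<open>Convolution of the source \<open>eta\<close> with the truncated Green function. Sources
  are confined to \<open>box (N - R)\<close> so that the kernel of range \<open>R\<close> does not
  reach beyond \<open>box N\<close>.\<close>

definition response :: "nat \<Rightarrow> nat \<Rightarrow> 'w \<Rightarrow> int^'d \<Rightarrow> real" where
  "response N R \<omega> x = (\<Sum>y\<in>box (N - R). green R (x - y) * eta (xi \<omega> y))"

lemma response_eq_0:
  assumes "R \<le> N" "x \<notin> box N"
  shows "response N R \<omega> x = 0"
  unfolding response_def
proof (rule sum.neutral, rule ballI)
  fix y :: "int^'d" assume "y \<in> box (N - R)"
  then have "sup_norm y \<le> N - R" by (simp add: sup_norm_le_iff)
  moreover have "N < sup_norm x" using assms sup_norm_le_iff[of x N] by auto
  moreover have "sup_norm x \<le> sup_norm (x - y) + sup_norm y" using sup_norm_triangle[of "x - y" y] by simp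
  ultimately have "R \<le> sup_norm (x - y)" using assms(1) by linarith
  then show "green R (x - y) * eta (xi \<omega> y) = 0" by (simp add: green_eq_0)
qed

text \<open>By independence the expected squared increment along an edge is the variance of
  \<open>eta\<close> times a sum over sources. Exchanging the sums leaves the energy of one shifted
  Green function per source; \<open>256 = 4 * 64\<close>.\<close>

lemma
  assumes d: "CARD('d) \<in> {1, 2}" and R: "R \<ge> 1"
  shows integrable_energy_response: "integrable M (\<lambda>\<omega>. energy N (response N R \<omega>))"
    and expectation_energy_response_le:
      "expectation (\<lambda>\<omega>. energy N (response N R \<omega>)) \<le> 256 * deg * green R (0 :: int^'d) * vol N"
proof -
  let ?v = "expectation (\<lambda>\<omega>. (eta (xi \<omega> 0))^2)" and ?I = "box (N - R) :: (int^'d) set"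
  let ?U = "unit_steps :: (int^'d) set"
  have "response N R \<omega> x - response N R \<omega> (x + z)
     = (\<Sum>y\<in>?I. (green R (x - y) - green R (x + z - y)) * eta (xi \<omega> y))" for \<omega> x z
    unfolding response_def sum_subtractf[symmetric] by (simp add: algebra_simps)
  then have eq: "energy N (response N R \<omega>)
     = (\<Sum>x\<in>box N. \<Sum>z\<in>?U. (\<Sum>y\<in>?I. (green R (x - y) - green R (x + z - y)) * eta (xi \<omega> y))^2)" for \<omega>
    unfolding energy_def by simp
  have i: "integrable M (\<lambda>\<omega>. (\<Sum>y\<in>?I. (green R (x - y) - green R (x + z - y)) * eta (xi \<omega> y))^2)" for x z
    by (rule integrable_weighted_sum_sq[OF borel_measurable_eta integrable_eta_sq expectation_eta finite_box])
  have e: "expectation (\<lambda>\<omega>. (\<Sum>y\<in>?I. (green R (x - y) - green R (x + z - y)) * eta (xi \<omega> y))^2)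
     = ?v * (\<Sum>y\<in>?I. (green R (x - y) - green R (x + z - y))^2)" for x z
    by (rule expectation_weighted_sum_sq[OF borel_measurable_eta integrable_eta_sq expectation_eta finite_box])
  show "integrable M (\<lambda>\<omega>. energy N (response N R \<omega>))"
    unfolding eq by (intro Bochner_Integration.integrable_sum i)
  have "expectation (\<lambda>\<omega>. energy N (response N R \<omega>))
     = (\<Sum>x\<in>box N. \<Sum>z\<in>?U. ?v * (\<Sum>y\<in>?I. (green R (x - y) - green R (x + z - y))^2))"
    unfolding eq e[symmetric]
    by (subst Bochner_Integration.integral_sum, intro Bochner_Integration.integrable_sum i)
       (intro sum.cong refl Bochner_Integration.integral_sum i)
  also have "\<dots> = ?v * (\<Sum>x\<in>box N. \<Sum>y\<in>?I. \<Sum>z\<in>?U. (green R (x - y) - green R (x + z - y))^2)"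
    unfolding sum_distrib_left[symmetric] by (subst sum.swap[of _ ?U]) (rule refl)
  also have "\<dots> = ?v * (\<Sum>y\<in>?I. \<Sum>x\<in>box N. \<Sum>z\<in>?U. (green R (x - y) - green R (x + z - y))^2)"
    by (subst sum.swap) (rule refl)
  also have "\<dots> \<le> 4 * (\<Sum>y\<in>?I. 64 * deg * green R (0 :: int^'d))"
    unfolding deg_def
    by (intro mult_mono expectation_eta_sq_le sum_mono sum_green_steps_le d R sum_nonneg) auto
  also have "\<dots> = 256 * deg * green R (0 :: int^'d) * vol (N - R)"
    by (simp add: vol_def)
  also have "\<dots> \<le> 256 * deg * green R (0 :: int^'d) * vol N"
  proof (rule mult_left_mono)
    have "card ?I \<le> card (box N :: (int^'d) set)"
      by (rule card_mono) (auto intro!: box_mono subsetD[OF box_mono, of "N - R" N])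
    then show "vol (N - R) \<le> vol N" by (simp add: vol_def)
  qed (use deg_nonneg green_nonneg[of R "0 :: int^'d"] in simp)
  finally show "expectation (\<lambda>\<omega>. energy N (response N R \<omega>)) \<le> 256 * deg * green R (0 :: int^'d) * vol N" .
qed

section \<open>Gain of the random response\<close>

definition offdiag :: "nat \<Rightarrow> nat \<Rightarrow> ((int^'d) \<times> (int^'d)) set" where
  "offdiag N R = {(x, y). x \<in> box N \<and> y \<in> box (N - R) \<and> x \<noteq> y}"

lemma finite_offdiag: "finite (offdiag N R)"
  by (rule finite_subset[of _ "box N \<times> box (N - R)"]) (auto simp: offdiag_def)

text \<open>The diagonal gives a systematic gain proportional to \<open>green R 0\<close>; the
  off-diagonal part is centred noise when the mean is zero.\<close>

lemma sum_xi_response: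
  "(\<Sum>x\<in>box N. xi \<omega> x * response N R \<omega> x)
    = green R (0 :: int^'d) * (\<Sum>y\<in>box (N - R). xi \<omega> y * eta (xi \<omega> y))
      + (\<Sum>(x,y)\<in>offdiag N R. green R (x - y) * (xi \<omega> x * eta (xi \<omega> y)))"
proof -
  let ?\<Lambda> = "box N :: (int^'d) set" and ?I = "box (N - R) :: (int^'d) set"
  let ?F = "\<lambda>(x,y). green R (x - y) * (xi \<omega> x * eta (xi \<omega> y))"
  have sub: "?I \<subseteq> ?\<Lambda>" by (rule box_mono) simp
  have "(\<Sum>x\<in>?\<Lambda>. xi \<omega> x * response N R \<omega> x) = (\<Sum>p\<in>?\<Lambda> \<times> ?I. ?F p)"
    unfolding response_def sum_distrib_left sum.cartesian_product
    by (intro sum.cong) (auto simp: mult_ac)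
  also have "?\<Lambda> \<times> ?I = (\<lambda>y. (y, y)) ` ?I \<union> offdiag N R"
    using sub by (auto simp: offdiag_def)
  also have "(\<Sum>p\<in>(\<lambda>y. (y, y)) ` ?I \<union> offdiag N R. ?F p) = (\<Sum>p\<in>(\<lambda>y. (y, y)) ` ?I. ?F p) + (\<Sum>p\<in>offdiag N R. ?F p)"
    by (rule sum.union_disjoint) (auto simp: finite_offdiag, auto simp: offdiag_def)
  also have "(\<Sum>p\<in>(\<lambda>y. (y, y)) ` ?I. ?F p) = (\<Sum>y\<in>?I. green R (0 :: int^'d) * (xi \<omega> y * eta (xi \<omega> y)))"
    by (subst sum.reindex) (auto simp: inj_on_def)
  finally show ?thesis by (simp add: sum_distrib_left)
qed

lemma sum_green_sq_offdiag_le: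
  "(\<Sum>(x,y)\<in>offdiag N R. (green R (x - y))^2)
    \<le> vol (N - R) * (real ((2 * R + 1) ^ CARD('d)) * (green R (0 :: int^'d))^2)"
proof -
  let ?\<Lambda> = "box N :: (int^'d) set" and ?I = "box (N - R) :: (int^'d) set"
  have "(\<Sum>(x,y)\<in>offdiag N R. (green R (x - y))^2) \<le> (\<Sum>(x,y)\<in>?\<Lambda> \<times> ?I. (green R (x - y))^2)"
    by (rule sum_mono2) (auto simp: offdiag_def)
  also have "\<dots> = (\<Sum>y\<in>?I. \<Sum>x\<in>?\<Lambda>. (green R (x - y))^2)"
    unfolding sum.cartesian_product[symmetric] by (rule sum.swap)
  also have "\<dots> \<le> (\<Sum>y\<in>?I. real ((2 * R + 1) ^ CARD('d)) * (green R (0 :: int^'d))^2)"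
    by (intro sum_mono sum_green_sq_le)
  finally show ?thesis by (simp add: vol_def)
qed

text \<open>The pair estimate with the identity for the untruncated factor and \<open>eta\<close>,
  bounded by \<open>2\<close>, for the other; hence \<open>8 = 2 * 2^2\<close>.\<close>

lemma prob_offdiag_ge:
  assumes mean: "mean = 0" and "T > 0"
  shows "prob {\<omega>\<in>space M. (\<Sum>(x,y)\<in>offdiag N R. green R (x - y) * (xi \<omega> x * eta (xi \<omega> y)))^2 \<ge> T^2}
    \<le> 8 * sq_mean * (vol (N - R) * (real ((2 * R + 1) ^ CARD('d)) * (green R (0 :: int^'d))^2)) / T^2"
proof (rule markov_le)
  have sym: "green R (x - y) = green R (y - x)" for x y :: "int^'d"
    using green_uminus[of R "x - y"] by simp
  note hyps = _ borel_measurable_eta sq_int mean expectation_eta abs_eta_le finite_offdiag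
  show "integrable M (\<lambda>\<omega>. (\<Sum>(x,y)\<in>offdiag N R. green R (x - y) * (xi \<omega> x * eta (xi \<omega> y)))^2)"
    by (rule integrable_offdiagonal_sum_sq[where f = "\<lambda>t. t" and k = "\<lambda>x y. green R (x - y)", OF hyps])
       (auto simp: offdiag_def intro: sym)
  have "expectation (\<lambda>\<omega>. (\<Sum>(x,y)\<in>offdiag N R. green R (x - y) * (xi \<omega> x * eta (xi \<omega> y)))^2)
     \<le> 2 * 2^2 * sq_mean * (\<Sum>(x,y)\<in>offdiag N R. (green R (x - y))^2)"
    by (rule expectation_offdiagonal_sum_sq_le[where f = "\<lambda>t. t" and k = "\<lambda>x y. green R (x - y)", OF hyps])
       (auto simp: offdiag_def intro: sym)
  also have "\<dots> \<le> 2 * 2^2 * sq_mean * (vol (N - R) * (real ((2 * R + 1) ^ CARD('d)) * (green R (0 :: int^'d))^2))"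
    by (intro mult_left_mono sum_green_sq_offdiag_le) auto
  finally show "expectation (\<lambda>\<omega>. (\<Sum>(x,y)\<in>offdiag N R. green R (x - y) * (xi \<omega> x * eta (xi \<omega> y)))^2)
     \<le> 8 * sq_mean * (vol (N - R) * (real ((2 * R + 1) ^ CARD('d)) * (green R (0 :: int^'d))^2))" by simp
qed (use assms in auto)

text \<open>As \<open>eta\<close> is bounded, \<open>t * eta t\<close> inherits a second moment from
  the disorder, so Chebyshev's inequality applies to the diagonal.\<close>

lemma prob_diag_ge:
  assumes "T > 0"
  shows "prob {\<omega>\<in>space M. (\<Sum>y\<in>box n. xi \<omega> y * eta (xi \<omega> y) - corr)^2 \<ge> T^2} \<le> 4 * sq_mean * vol n / T^2"
proof (rule markov_le)
  define f where "f t = t * eta t - corr" for t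
  have fm: "f \<in> borel_measurable borel" unfolding f_def[abs_def] by measurable
  have f0: "expectation (\<lambda>\<omega>. f (xi \<omega> 0)) = 0"
    unfolding f_def using integrable_xi_eta by (simp add: corr_def prob_space)
  have fsq: "(f (xi \<omega> 0))^2 = (xi \<omega> 0 * eta (xi \<omega> 0))^2 - 2 * corr * (xi \<omega> 0 * eta (xi \<omega> 0)) + corr^2" for \<omega>
    by (simp add: f_def power2_eq_square algebra_simps)
  have fi: "integrable M (\<lambda>\<omega>. (f (xi \<omega> 0))^2)"
    unfolding fsq using integrable_xi_eta integrable_xi_eta_sq by simp
  have "expectation (\<lambda>\<omega>. (f (xi \<omega> 0))^2) = expectation (\<lambda>\<omega>. (xi \<omega> 0 * eta (xi \<omega> 0))^2) - 2 * corr * corr + corr^2"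
    unfolding fsq using integrable_xi_eta integrable_xi_eta_sq by (simp add: prob_space corr_def)
  also have "\<dots> \<le> 4 * sq_mean"
    using expectation_xi_eta_sq_le zero_le_power2[of corr] unfolding power2_eq_square[of corr] by linarith
  finally have fe: "expectation (\<lambda>\<omega>. (f (xi \<omega> 0))^2) \<le> 4 * sq_mean" .
  have eq: "(\<Sum>y\<in>box n. xi \<omega> y * eta (xi \<omega> y) - corr) = (\<Sum>y\<in>(box n :: (int^'d) set). 1 * f (xi \<omega> y))" for \<omega>
    by (simp add: f_def)
  show "integrable M (\<lambda>\<omega>. (\<Sum>y\<in>box n. xi \<omega> y * eta (xi \<omega> y) - corr)^2)"
    unfolding eq by (rule integrable_weighted_sum_sq[OF fm fi f0 finite_box])
  have "expectation (\<lambda>\<omega>. (\<Sum>y\<in>box n. xi \<omega> y * eta (xi \<omega> y) - corr)^2)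
     = expectation (\<lambda>\<omega>. (f (xi \<omega> 0))^2) * (\<Sum>y\<in>(box n :: (int^'d) set). 1^2)"
    unfolding eq by (rule expectation_weighted_sum_sq[OF fm fi f0 finite_box])
  also have "\<dots> = expectation (\<lambda>\<omega>. (f (xi \<omega> 0))^2) * vol n" by (simp add: vol_def)
  also have "\<dots> \<le> 4 * sq_mean * vol n" using vol_pos[of n] by (intro mult_right_mono fe) simp
  finally show "expectation (\<lambda>\<omega>. (\<Sum>y\<in>box n. xi \<omega> y * eta (xi \<omega> y) - corr)^2) \<le> 4 * sq_mean * vol n" .
qed (use assms in auto)

lemma energy_scale: "energy N (\<lambda>x. c * h x) = c^2 * energy N h"
  unfolding energy_def sum_distrib_left
  by (intro sum.cong refl) (simp add: power_mult_distrib right_diff_distrib[symmetric])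

text \<open>On the good event the scaled response gains at least \<open>4 * T\<close>, its energy
  costs at most \<open>T\<close>, and the tilt sum is at most \<open>T\<close>. The total
  \<open>T + T / 2 - 2 * T\<close> equals \<open>- T / 2\<close>, and
  \<open>T / v = \<gamma> * g\<close> can be made arbitrarily large by the choice of scales.\<close>

lemma surface_tension_unbounded_mean_zero:
  assumes d: "CARD('d) \<in> {1, 2}" and mean: "mean = 0" and sq: "sq_mean \<noteq> 0" and \<delta>: "\<delta> > 0"
  shows "\<exists>N. \<exists>Bd\<in>events. prob Bd \<le> \<delta> \<and> (\<forall>\<omega>\<in>space M - Bd. surface_tension V N (xi \<omega>) u \<le> - K)"
proof -
  define L where "L = 5 * (expectation (\<lambda>\<omega>. \<bar>xi \<omega> 0\<bar>) + 1) / \<delta>"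
  \<comment> \<open>Makes Markov's inequality give at most \<open>\<delta> / 5\<close> for the
    energy; the \<open>+ 1\<close> keeps \<open>E\<close> positive.\<close>
  define E where "E = 5 * 256 * deg / \<delta> + 1"
  \<comment> \<open>Balances quadratic cost against linear gain:
    \<open>3 * C * lam^2 * E = lam * corr / 32 = \<gamma>\<close>, a quarter of the guaranteed gain
    \<open>lam * corr / 8\<close> per site and unit of \<open>g\<close>.\<close>
  define lam where "lam = corr / (96 * C * E)"
  define \<gamma> where "\<gamma> = lam * corr / 32"
  \<comment> \<open>\<open>c2\<close> and \<open>c5\<close> are the coefficients that Chebyshev's
    inequality produces for the tilt sum and the off-diagonal sum. \<open>\<epsilon>\<close> makes
    both \<open>c2 * \<epsilon>\<close> and \<open>c5 * \<epsilon>\<close> at most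
    \<open>\<delta> / 5\<close>.\<close>
  define c2 where "c2 = var * slope^2 / \<gamma>^2"
  define c5 where "c5 = 128 * sq_mean / corr^2"
  define \<epsilon> where "\<epsilon> = \<delta> / (5 * (c2 + c5 + 1))"
  have a: "corr > 0" by (rule corr_pos[OF mean sq])
  have Eabs: "expectation (\<lambda>\<omega>. \<bar>xi \<omega> 0\<bar>) \<ge> 0" by simp
  have L: "L > 0" using \<delta> Eabs by (simp add: L_def add_nonneg_pos)
  have E: "E > 0" using \<delta> deg_nonneg by (simp add: E_def add_nonneg_pos)
  have lam: "lam > 0" using a C_pos E by (simp add: lam_def)
  have \<gamma>: "\<gamma> > 0" using lam a by (simp add: \<gamma>_def)
  have c25: "c2 \<ge> 0" "c5 \<ge> 0" by (simp_all add: c2_def c5_def)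
  have \<epsilon>: "\<epsilon> > 0" using \<delta> c25 by (simp add: \<epsilon>_def add_nonneg_pos)
  have "c2 + c5 + 1 \<noteq> 0" using c25 by linarith
  moreover have "r * (\<delta> / (5 * r)) = \<delta> / 5" if "r \<noteq> 0" for r :: real using that by simp
  ultimately have "(c2 + c5 + 1) * \<epsilon> = \<delta> / 5" unfolding \<epsilon>_def by blast
  then have \<epsilon>2: "c2 * \<epsilon> \<le> \<delta> / 5" and \<epsilon>5: "c5 * \<epsilon> \<le> \<delta> / 5"
    using \<epsilon> mult_nonneg_nonneg[OF c25(1), of \<epsilon>] mult_nonneg_nonneg[OF c25(2), of \<epsilon>]
    by (simp_all add: distrib_right)
  obtain N R where R: "1 \<le> R" "R \<le> N"
    and G: "green R (0 :: int^'d) \<ge> 2 * (base_cost + L / 4 + K) / \<gamma>"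
    and s1: "real N ^ 2 \<le> \<epsilon> * (green R (0 :: int^'d))^2 * vol N"
    and s2: "real ((2 * R + 1) ^ CARD('d)) \<le> \<epsilon> * vol (N - R)"
    and s3: "vol N \<le> 4 * vol (N - R)"
    using exists_scales[OF d \<epsilon>, of "2 * (base_cost + L / 4 + K) / \<gamma>"] unfolding vol_def by blast
  define g where "g = green R (0 :: int^'d)"
  have g: "g \<ge> 1" unfolding g_def by (rule green_0_ge_1[OF R(1)])
  define v where "v = vol N"
  define v' where "v' = vol (N - R)"
  have v: "v > 0" "v' > 0" by (simp_all add: v_def v'_def vol_pos)
  define T where "T = \<gamma> * g * v"
  define T4 where "T4 = corr * v' / 4"
  define T5 where "T5 = corr * g * v' / 4"
  have T: "T > 0" "T4 > 0" "T5 > 0" using \<gamma> g v a by (simp_all add: T_def T4_def T5_def)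
  let ?Q = "\<lambda>\<omega>. \<Sum>y\<in>(box (N - R) :: (int^'d) set). xi \<omega> y * eta (xi \<omega> y) - corr"
  let ?O = "\<lambda>\<omega>. \<Sum>(x,y)\<in>offdiag N R. green R (x - y) * (xi \<omega> x * eta (xi \<omega> y))"
  define B1 where "B1 = {\<omega>\<in>space M. (\<Sum>x\<in>box N. \<bar>xi \<omega> x\<bar>) \<ge> L * vol N}"
  define B2 where "B2 = {\<omega>\<in>space M. (\<Sum>x\<in>box N. tilt u x * (xi \<omega> x - mean))^2 \<ge> T^2}"
  define B3 where "B3 = {\<omega>\<in>space M. energy N (response N R \<omega>) \<ge> E * (g * v)}"
  define B4 where "B4 = {\<omega>\<in>space M. (?Q \<omega>)^2 \<ge> T4^2}"
  define B5 where "B5 = {\<omega>\<in>space M. (?O \<omega>)^2 \<ge> T5^2}"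
  have ev12: "B1 \<in> events" "B2 \<in> events" unfolding B1_def B2_def by measurable
  have [measurable]: "(\<lambda>\<omega>. energy N (response N R \<omega>)) \<in> borel_measurable M"
    using integrable_energy_response[OF d R(1)] by simp
  have ev3: "B3 \<in> events" unfolding B3_def by measurable
  have ev4: "B4 \<in> events" unfolding B4_def by measurable
  have ev5: "B5 \<in> events" unfolding B5_def case_prod_unfold by measurable
  have p1: "prob B1 \<le> \<delta> / 5"
  proof -
    have "prob B1 \<le> expectation (\<lambda>\<omega>. \<bar>xi \<omega> 0\<bar>) / L" unfolding B1_def by (rule prob_abs_sum_ge[OF L])
    also have "\<dots> \<le> \<delta> / 5"
    proof -
      have "\<delta> / 5 * L = expectation (\<lambda>\<omega>. \<bar>xi \<omega> 0\<bar>) + 1" using \<delta> by (simp add: L_def)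
      then show ?thesis by (simp add: pos_divide_le_eq[OF L])
    qed
    finally show ?thesis .
  qed
  have p2: "prob B2 \<le> \<delta> / 5"
  proof -
    have "prob B2 \<le> var * ((real N * slope)^2 * vol N) / T^2"
      unfolding B2_def by (rule prob_centered_sum_ge[OF T(1) sum_tilt_sq_le]) simp
    also have "\<dots> = c2 * (real N ^ 2 / (g^2 * v))"
      unfolding c2_def T_def v_def[symmetric] using v g \<gamma>
      by (simp add: power_mult_distrib power2_eq_square divide_simps)
    also have "\<dots> \<le> c2 * \<epsilon>"
    proof (rule mult_left_mono[OF _ c25(1)])
      have "real N ^ 2 \<le> \<epsilon> * (g^2 * v)" using s1 by (simp add: g_def v_def mult_ac)
      then show "real N ^ 2 / (g^2 * v) \<le> \<epsilon>" using g v by (simp add: pos_divide_le_eq)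
    qed
    finally show ?thesis using \<epsilon>2 by linarith
  qed
  have p3: "prob B3 \<le> \<delta> / 5"
  proof -
    have "prob B3 \<le> (256 * deg * g * v) / (E * (g * v))"
      unfolding B3_def g_def v_def
    proof (rule markov_le[OF integrable_energy_response[OF d R(1)] _ _ expectation_energy_response_le[OF d R(1)]])
      show "0 \<le> energy N (response N R \<omega>)" for \<omega>
        unfolding energy_def by (intro sum_nonneg) auto
      show "0 < E * (green R (0 :: int^'d) * vol N)"
        using E g v by (simp add: g_def[symmetric] v_def[symmetric])
    qed
    also have "\<dots> = 256 * deg / E" using g v by simp
    also have "\<dots> \<le> \<delta> / 5"
    proof -
      have "\<delta> / 5 * E = 256 * deg + \<delta> / 5" using \<delta> by (simp add: E_def field_simps)
      then show ?thesis using \<delta> by (simp add: pos_divide_le_eq[OF E])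
    qed
    finally show ?thesis .
  qed
  have p4: "prob B4 \<le> \<delta> / 5"
  proof -
    have "prob B4 \<le> 4 * sq_mean * v' / T4^2"
      unfolding B4_def v'_def by (rule prob_diag_ge[OF T(2)])
    also have "\<dots> = (64 * sq_mean / corr^2) * (1 / v')"
      unfolding T4_def using v a by (simp add: power_mult_distrib power2_eq_square divide_simps)
    also have "\<dots> \<le> c5 * \<epsilon>"
    proof (rule mult_mono)
      show "64 * sq_mean / corr^2 \<le> c5" unfolding c5_def by (intro divide_right_mono) auto
      \<comment> \<open>The left side of \<open>s2\<close> is at least one, so \<open>s2\<close>
        also bounds \<open>1 / v'\<close> by \<open>\<epsilon>\<close>.\<close>
      have "1 \<le> real ((2 * R + 1) ^ CARD('d))" by simp
      then have "1 \<le> \<epsilon> * v'" using s2 unfolding v'_def by linarith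
      then show "1 / v' \<le> \<epsilon>" using v by (simp add: pos_divide_le_eq)
    qed (use c25 v in auto)
    finally show ?thesis using \<epsilon>5 by linarith
  qed
  have p5: "prob B5 \<le> \<delta> / 5"
  proof -
    have "prob B5 \<le> 8 * sq_mean * (v' * (real ((2 * R + 1) ^ CARD('d)) * g^2)) / T5^2"
      unfolding B5_def v'_def g_def by (rule prob_offdiag_ge[OF mean T(3)])
    also have "\<dots> = c5 * (real ((2 * R + 1) ^ CARD('d)) / v')"
      unfolding T5_def c5_def using v a g by (simp add: power_mult_distrib power2_eq_square divide_simps)
    also have "\<dots> \<le> c5 * \<epsilon>"
      using s2 v by (intro mult_left_mono c25) (simp add: pos_divide_le_eq v'_def)
    finally show ?thesis using \<epsilon>5 by linarith
  qed
  define Bd where "Bd = B1 \<union> B2 \<union> B3 \<union> B4 \<union> B5"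
  have ev: "Bd \<in> events" unfolding Bd_def by (intro sets.Un ev12 ev3 ev4 ev5)
  have "prob Bd \<le> prob B1 + prob B2 + prob B3 + prob B4 + prob B5"
    unfolding Bd_def using ev12 ev3 ev4 ev5
    by (intro order_trans[OF measure_Un_le] add_right_mono sets.Un order_refl)
  then have "prob Bd \<le> \<delta>" using p1 p2 p3 p4 p5 by linarith
  moreover have "surface_tension V N (xi \<omega>) u \<le> - K" if w: "\<omega> \<in> space M - Bd" for \<omega>
  proof -
    have b1: "(\<Sum>x\<in>box N. \<bar>xi \<omega> x\<bar>) \<le> L * v"
      using w unfolding Bd_def B1_def v_def by auto
    have b3: "energy N (response N R \<omega>) \<le> E * (g * v)"
      using w unfolding Bd_def B3_def by auto
    have "(\<Sum>x\<in>box N. tilt u x * (xi \<omega> x - mean))^2 < T^2" "(?Q \<omega>)^2 < T4^2" "(?O \<omega>)^2 < T5^2"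
      using w unfolding Bd_def B2_def B4_def B5_def by auto
    then have b: "\<bar>\<Sum>x\<in>box N. tilt u x * (xi \<omega> x - mean)\<bar> \<le> T" "\<bar>?Q \<omega>\<bar> \<le> T4" "\<bar>?O \<omega>\<bar> \<le> T5"
      using T by (auto intro!: abs_le_of_sq_less)
    have 2: "(\<Sum>x\<in>box N. xi \<omega> x * tilt u x) \<le> T" using b(1) by (simp add: mean mult.commute)
    have "(\<Sum>y\<in>(box (N - R) :: (int^'d) set). xi \<omega> y * eta (xi \<omega> y)) = ?Q \<omega> + corr * v'"
      by (simp add: sum_subtractf v'_def vol_def mult.commute)
    \<comment> \<open>The diagonal deviates from its mean by at most a quarter; the off-diagonal
      part will take another quarter, leaving one half.\<close>
    then have "(\<Sum>y\<in>(box (N - R) :: (int^'d) set). xi \<omega> y * eta (xi \<omega> y)) \<ge> 3 / 4 * corr * v'"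
      using b(2) unfolding T4_def by linarith
    then have "g * (\<Sum>y\<in>(box (N - R) :: (int^'d) set). xi \<omega> y * eta (xi \<omega> y)) \<ge> g * (3 / 4 * corr * v')"
      using g by (intro mult_left_mono) auto
    then have "(\<Sum>x\<in>box N. xi \<omega> x * response N R \<omega> x) \<ge> g * (3 / 4 * corr * v') - T5"
      unfolding sum_xi_response g_def[symmetric] using b(3) by linarith
    also have "g * (3 / 4 * corr * v') - T5 = g * corr / 2 * v'" by (simp add: T5_def)
    finally have W: "(\<Sum>x\<in>box N. xi \<omega> x * response N R \<omega> x) \<ge> g * corr / 2 * v'" .
    \<comment> \<open>\<open>s3\<close> passes from the volume of the inner box to that of the full
      box.\<close>
    have "g * corr / 2 * v' \<ge> g * corr / 2 * (v / 4)"
      using s3 g a unfolding v_def v'_def by (intro mult_left_mono) auto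
    then have W': "(\<Sum>x\<in>box N. xi \<omega> x * response N R \<omega> x) \<ge> g * corr / 2 * (v / 4)" using W by linarith
    have "(\<Sum>x\<in>box N. xi \<omega> x * (- lam * response N R \<omega> x)) = - (lam * (\<Sum>x\<in>box N. xi \<omega> x * response N R \<omega> x))"
      by (simp add: sum_distrib_left sum_negf mult_ac)
    also have "\<dots> \<le> - (lam * (g * corr / 2 * (v / 4)))"
      using W' lam by simp
    also have "\<dots> = - 4 * T" by (simp add: T_def \<gamma>_def)
    finally have 3: "(\<Sum>x\<in>box N. xi \<omega> x * (- lam * response N R \<omega> x)) \<le> - 4 * T" .
    have "energy N (\<lambda>x. - lam * response N R \<omega> x) = lam^2 * energy N (response N R \<omega>)"
      using energy_scale[of N "- lam" "response N R \<omega>"] by simp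
    also have "\<dots> \<le> lam^2 * (E * (g * v))" by (intro mult_left_mono b3) simp
    finally have "3 * C * energy N (\<lambda>x. - lam * response N R \<omega> x) \<le> 3 * C * (lam^2 * (E * (g * v)))"
      using C_pos by simp
    also have "\<dots> = T"
      unfolding T_def \<gamma>_def using C_pos E by (simp add: lam_def power2_eq_square)
    finally have 4: "3 * C * energy N (\<lambda>x. - lam * response N R \<omega> x) \<le> T" .
    have "surface_tension V N (xi \<omega>) u \<le> base_cost + (3 * C * energy N (\<lambda>x. - lam * response N R \<omega> x)
      + (\<Sum>x\<in>box N. xi \<omega> x * tilt u x) / 2 + (\<Sum>x\<in>box N. xi \<omega> x * (- lam * response N R \<omega> x)) / 2
      + (\<Sum>x\<in>box N. \<bar>xi \<omega> x\<bar>) / 4) / v"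
      unfolding v_def by (rule interface_bound) (simp add: response_eq_0 R)
    also have "\<dots> \<le> base_cost + (T + T / 2 + (- 4 * T) / 2 + (L * v) / 4) / v"
    proof (rule add_left_mono, rule divide_right_mono)
      show "3 * C * energy N (\<lambda>x. - lam * response N R \<omega> x)
        + (\<Sum>x\<in>box N. xi \<omega> x * tilt u x) / 2 + (\<Sum>x\<in>box N. xi \<omega> x * (- lam * response N R \<omega> x)) / 2
        + (\<Sum>x\<in>box N. \<bar>xi \<omega> x\<bar>) / 4 \<le> T + T / 2 + (- 4 * T) / 2 + (L * v) / 4"
        using 2 3 4 b1 by linarith
    qed (use v in simp)
    also have "\<dots> = base_cost + L / 4 - \<gamma> * g / 2"
      using v by (simp add: T_def field_simps)
    also have "\<dots> \<le> - K"
    proof -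
      have "2 * (base_cost + L / 4 + K) \<le> g * \<gamma>" using G \<gamma> by (simp add: g_def pos_divide_le_eq)
      then show ?thesis by (simp add: mult.commute)
    qed
    finally show ?thesis .
  qed
  ultimately show ?thesis using ev by (intro exI[of _ N] bexI[of _ Bd]) auto
qed

end

theorem theorem1p3:
  fixes V :: "real \<Rightarrow> real" and V' V'' :: "real \<Rightarrow> real"
    and A B C2 :: real
    and M :: "'w measure" and xi :: "'w \<Rightarrow> int^'d \<Rightarrow> real"
  assumes V_deriv: "\<And>s. (V has_real_derivative V' s) (at s)"
    and V'_deriv: "\<And>s. (V' has_real_derivative V'' s) (at s)"
    and V''_cont: "continuous_on UNIV V''"
    and V_even: "\<And>s. V (- s) = V s"
    and A_pos: "A > 0"
    and V_lower: "\<And>s. V s \<ge> A * s^2 - B"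
    and C2_pos: "C2 > 0"
    and V''_upper: "\<And>s. V'' s \<le> C2"
    and prob: "prob_space M"
    and xi_meas: "\<And>x. (\<lambda>\<omega>. xi \<omega> x) \<in> borel_measurable M"
    and xi_indep: "prob_space.indep_vars M (\<lambda>_. borel) (\<lambda>x \<omega>. xi \<omega> x) UNIV"
    and xi_ident: "\<And>x. distr M borel (\<lambda>\<omega>. xi \<omega> x) = distr M borel (\<lambda>\<omega>. xi \<omega> 0)"
    and xi_sq_int: "integrable M (\<lambda>\<omega>. (xi \<omega> 0)^2)"
    and xi_sq_nz: "(\<integral>\<omega>. (xi \<omega> 0)^2 \<partial>M) \<noteq> 0"
    and dim: "CARD('d) \<in> {1, 2} \<or> (CARD('d) \<ge> 3 \<and> (\<integral>\<omega>. xi \<omega> 0 \<partial>M) \<noteq> 0)"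
  shows "\<forall>u :: real^'d. AE \<omega> in M. \<not> convergent (\<lambda>N. surface_tension V N (xi \<omega>) u)"
proof
  fix u :: "real^'d"
  have V_meas: "V \<in> borel_measurable borel"
    using V_deriv by (intro borel_measurable_continuous_onI continuous_at_imp_continuous_on) (auto intro: DERIV_isCont)
  \<comment> \<open>The absolute value provides the nonnegative offset that \<open>b_nonneg\<close>
    asks for.\<close>
  have V_upper: "V s \<le> \<bar>V 0\<bar> + C2 * s^2" for s
    using even_potential_upper[OF V_deriv V'_deriv V_even V''_upper, of s] C2_pos by linarith
  interpret prob_space M by (rule prob)
  interpret disordered_interface M xi V A B "\<bar>V 0\<bar>" C2 u
  proof unfold_locales
    show "distr M borel (\<lambda>\<omega>. xi \<omega> x) = distr M borel (\<lambda>\<omega>. xi \<omega> y)" for x y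
      using xi_ident[of x] xi_ident[of y] by simp
  qed (use xi_meas xi_indep V_meas A_pos V_lower V_upper C2_pos xi_sq_int in auto)
  show "AE \<omega> in M. \<not> convergent (\<lambda>N. surface_tension V N (xi \<omega>) u)"
  proof (rule AE_not_convergent_if_unbounded)
    fix K \<delta> :: real assume \<delta>: "\<delta> > 0"
    show "\<exists>N. \<exists>Bd\<in>events. prob Bd \<le> \<delta> \<and> (\<forall>\<omega>\<in>space M - Bd. surface_tension V N (xi \<omega>) u \<le> - K)"
    \<comment> \<open>Zero mean leaves only dimensions one and two; a nonzero mean is handled in
      every dimension.\<close>
    proof (cases "expectation (\<lambda>\<omega>. xi \<omega> 0) = 0")
      case True
      then have "CARD('d) \<in> {1, 2}" using dim by simp
      then show ?thesis by (rule surface_tension_unbounded_mean_zero[OF _ True xi_sq_nz \<delta>])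
    qed (rule surface_tension_unbounded_mean_nonzero[OF _ \<delta>])
  qed
qed

end
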